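(* There exist a transitive nonunimodular graph $G$ with infinitely many ends and a random spanning tree $\omega$ of $G$ whose distribution is invariant under $\mathrm{Aut}(G)$ such that $p_c(\omega)=1$ almost surely.
   Context: All graphs are locally finite; transitive graphs are infinite and connected. $\mathrm{Aut}(G)$ is the automorphism group of $G$, and $S_x=\{g\in \mathrm{Aut}(G): g(x)=x\}$ is the stabilizer of a vertex $x$. A transitive graph $G$ is unimodular if $|S_xy|=|S_yx|$ for all $x,y\in V(G)$; otherwise it is nonunimodular. For a connected graph $H$, $p_c(H)$ is the infimum of $p\in[0,1]$ such that, when each edge of $H$ is independently kept with probability $p$ and removed otherwise, the connected component of a fixed vertex is infinite with positive probability (this does not depend on the vertex). A spanning tree of $G$ is a subgraph that is a tree and contains all vertices of $G$. *)

theory Defs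
  imports "HOL-Probability.Probability"
begin

text \<open>
  A simple undirected graph is given by a vertex set \<open>V\<close> and a set \<open>E\<close> of two-element subsets
  of \<open>V\<close>.
\<close>

definition graph :: "'v set \<Rightarrow> 'v set set \<Rightarrow> bool" where
  "graph V E \<longleftrightarrow> (\<forall>e\<in>E. \<exists>x\<in>V. \<exists>y\<in>V. x \<noteq> y \<and> e = {x, y})"

definition adj :: "'v set set \<Rightarrow> 'v rel" where
  "adj E = {(x, y). {x, y} \<in> E}"

definition locally_finite :: "'v set \<Rightarrow> 'v set set \<Rightarrow> bool" where
  "locally_finite V E \<longleftrightarrow> (\<forall>x\<in>V. finite {y. (x, y) \<in> adj E})"

definition component :: "'v set set \<Rightarrow> 'v \<Rightarrow> 'v set" where
  "component E x = {y. (x, y) \<in> (adj E)\<^sup>*}"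

definition connected_graph :: "'v set \<Rightarrow> 'v set set \<Rightarrow> bool" where
  "connected_graph V E \<longleftrightarrow> V \<noteq> {} \<and> (\<forall>x\<in>V. \<forall>y\<in>V. y \<in> component E x)"


subsection \<open>Automorphisms, transitivity, unimodularity\<close>

text \<open>Extensionality makes an automorphism determined by its values on \<open>V\<close>.\<close>

definition Aut :: "'v set \<Rightarrow> 'v set set \<Rightarrow> ('v \<Rightarrow> 'v) set" where
  "Aut V E = {g \<in> extensional V. bij_betw g V V \<and>
     (\<forall>x\<in>V. \<forall>y\<in>V. {g x, g y} \<in> E \<longleftrightarrow> {x, y} \<in> E)}"

definition stabilizer :: "'v set \<Rightarrow> 'v set set \<Rightarrow> 'v \<Rightarrow> ('v \<Rightarrow> 'v) set" where
  "stabilizer V E x = {g \<in> Aut V E. g x = x}"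

definition stab_orbit :: "'v set \<Rightarrow> 'v set set \<Rightarrow> 'v \<Rightarrow> 'v \<Rightarrow> 'v set" where
  "stab_orbit V E x y = (\<lambda>g. g y) ` stabilizer V E x"

definition transitive_graph :: "'v set \<Rightarrow> 'v set set \<Rightarrow> bool" where
  "transitive_graph V E \<longleftrightarrow>
     graph V E \<and> locally_finite V E \<and> infinite V \<and> connected_graph V E \<and>
     (\<forall>x\<in>V. \<forall>y\<in>V. \<exists>g\<in>Aut V E. g x = y)"

text \<open>In a connected locally finite graph all orbits of vertex stabilizers are finite, so
  \<open>card\<close> is their true cardinality.\<close>

definition unimodular :: "'v set \<Rightarrow> 'v set set \<Rightarrow> bool" where
  "unimodular V E \<longleftrightarrow>
     (\<forall>x\<in>V. \<forall>y\<in>V. card (stab_orbit V E x y) = card (stab_orbit V E y x))"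


subsection \<open>Ends\<close>

definition ray :: "'v set \<Rightarrow> 'v set set \<Rightarrow> (nat \<Rightarrow> 'v) \<Rightarrow> bool" where
  "ray V E r \<longleftrightarrow> inj r \<and> range r \<subseteq> V \<and> (\<forall>n. (r n, r (Suc n)) \<in> adj E)"

text \<open>Two rays are equivalent if, for every finite \<open>S \<subseteq> V\<close>, they have tails in the same
  component of the graph obtained by deleting \<open>S\<close>.\<close>

definition end_rel :: "'v set \<Rightarrow> 'v set set \<Rightarrow> (nat \<Rightarrow> 'v) rel" where
  "end_rel V E = {(r, s). ray V E r \<and> ray V E s \<and>
     (\<forall>S. finite S \<and> S \<subseteq> V \<longrightarrow>
       (\<exists>N. \<forall>m\<ge>N. \<forall>n\<ge>N. r m \<notin> S \<and> s n \<notin> S \<and>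
          s n \<in> component {e \<in> E. e \<inter> S = {}} (r m)))}"

definition ends :: "'v set \<Rightarrow> 'v set set \<Rightarrow> (nat \<Rightarrow> 'v) set set" where
  "ends V E = {r. ray V E r} // end_rel V E"


subsection \<open>Trees\<close>

definition cycle :: "'v set set \<Rightarrow> 'v list \<Rightarrow> bool" where
  "cycle E xs \<longleftrightarrow> 3 \<le> length xs \<and> distinct xs \<and>
     (\<forall>i<length xs. (xs ! i, xs ! (Suc i mod length xs)) \<in> adj E)"

definition tree :: "'v set \<Rightarrow> 'v set set \<Rightarrow> bool" where
  "tree V T \<longleftrightarrow> graph V T \<and> connected_graph V T \<and> (\<nexists>xs. cycle T xs)"

definition spanning_tree :: "'v set \<Rightarrow> 'v set set \<Rightarrow> 'v set set \<Rightarrow> bool" where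
  "spanning_tree V E T \<longleftrightarrow> T \<subseteq> E \<and> tree V T"


subsection \<open>Bernoulli bond percolation\<close>

definition percolation :: "'v set set \<Rightarrow> real \<Rightarrow> ('v set \<Rightarrow> bool) measure" where
  "percolation E p = PiM E (\<lambda>_. measure_pmf (bernoulli_pmf p))"

definition percolation_prob :: "'v set set \<Rightarrow> 'v \<Rightarrow> real \<Rightarrow> real" where
  "percolation_prob E x p =
     measure (percolation E p)
       {\<xi> \<in> space (percolation E p). infinite (component {e \<in> E. \<xi> e} x)}"

text \<open>The critical probability of the graph with edge set \<open>E\<close>, computed at the vertex \<open>x\<close>.\<close>

definition p_c :: "'v set set \<Rightarrow> 'v \<Rightarrow> real" where
  "p_c E x = Inf {p \<in> {0..1}. percolation_prob E x p > 0}"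


subsection \<open>Random spanning trees\<close>

text \<open>Subsets of \<open>E\<close> with the product \<open>\<sigma>\<close>-algebra of \<open>{0,1}\<^sup>E\<close>, generated by the events
  that a given edge is present.\<close>

definition edge_subsets :: "'v set set \<Rightarrow> 'v set set measure" where
  "edge_subsets E = sigma (Pow E) {{F \<in> Pow E. e \<in> F} | e. e \<in> E}"

text \<open>A random spanning tree is represented by its distribution.\<close>

definition random_spanning_tree ::
    "'v set \<Rightarrow> 'v set set \<Rightarrow> 'v set set measure \<Rightarrow> bool" where
  "random_spanning_tree V E \<mu> \<longleftrightarrow>
     prob_space \<mu> \<and> sets \<mu> = sets (edge_subsets E) \<and> (AE T in \<mu>. spanning_tree V E T)"

definition Aut_invariant :: "'v set \<Rightarrow> 'v set set \<Rightarrow> 'v set set measure \<Rightarrow> bool" where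
  "Aut_invariant V E \<mu> \<longleftrightarrow>
     (\<forall>g\<in>Aut V E. distr \<mu> \<mu> (\<lambda>T. (\<lambda>e. g ` e) ` T) = \<mu>)"

end

theory Submission
  imports Defs "HOL-Library.Discrete_Functions" "HOL-Real_Asymp.Real_Asymp"
begin

text \<open>
  The graph \<open>G\<close> joins every vertex of the binary tree with a fixed end to its three nearest ancestors
  towards that end. Pick for every vertex a uniformly random favourite child, and for every level
  (horocycle) an independent random label. A segment starts at a head and follows
  favourite children until a label exceeds the label at the head's level. The spanning tree
  traverses a segment \<open>y\<^sub>0, \<dots>, y\<^sub>R\<close> along the path \<open>y\<^sub>0, y\<^sub>2, \<dots>\<close> down to the bottom, then along the odd
  vertices up to \<open>y\<^sub>1\<close>, and from there it leaves towards the end of the tree; the segments hanging off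
  it are attached to even vertices. So whatever is not on the favourite line of a head can be reached
  from above only after a detour through the whole segment.

  Fix \<open>p < 1\<close>, a vertex \<open>x\<close> and a remote ancestor \<open>a\<close> of \<open>x\<close>. With probability one there are arbitrarily
  large \<open>A\<close> such that a record label occurs within the first \<open>A\<close> levels below \<open>a\<close> and stays maximal for
  \<open>K\<^sup>2 A\<close> levels. All the at most \<open>2\<^sup>A\<close> descendants of \<open>a\<close> at that level are heads of segments of length about
  \<open>K\<^sup>2 A\<close>. A descendant of \<open>a\<close> at depth \<open>K A\<close> either lies on one of these segments, at distance about
  \<open>K A\<close> from \<open>x\<close>, or is one of at most \<open>2\<^bsup>K A\<^esup>\<close> vertices behind a detour of length about \<open>K\<^sup>2 A\<close>. For large
  \<open>K\<close> the expected number of these vertices connected to \<open>x\<close> is small. All vertices of a level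
  share its label, which is why the number of levels swept by one record can have infinite mean; an independent
  choice for every vertex would behave like a supercritical branching process.
\<close>

section \<open>The graph\<close>

locale horo_tree =
  fixes par :: "nat \<Rightarrow> nat" and lev :: "nat \<Rightarrow> int"
  assumes lev_par [simp]: "lev (par x) = lev x - 1"
    and common_ancestor: "\<exists>m n. (par ^^ m) x = (par ^^ n) y"
    and card_children: "card {y. par y = x} = 2"
    and homogeneous: "\<exists>g. bij g \<and> (\<forall>z. g (par z) = par (g z)) \<and> g x = y"
begin

lemma lev_anc [simp]: "lev ((par ^^ n) x) = lev x - int n"
  by (induction n) auto

lemma anc_add: "(par ^^ m) ((par ^^ n) x) = (par ^^ (m + n)) x"
  by (simp add: funpow_add)

lemma finite_children: "finite {y. par y = x}"
  using card_children[of x] card.infinite by fastforce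

lemma two_children: "\<exists>u v. u \<noteq> v \<and> par u = x \<and> par v = x"
  using card_children[of x] by (auto simp: card_2_iff set_eq_iff)

definition rel :: "nat \<Rightarrow> nat \<Rightarrow> nat \<Rightarrow> bool" where
  "rel k x y \<longleftrightarrow> y = (par ^^ k) x \<or> x = (par ^^ k) y"

text \<open>Spans of up to three generations accommodate the spanning tree: it moves by two
  generations within a segment, and it leaves from position 1 to the parent or grandparent of the
  head.\<close>

definition edges :: "nat set set" where
  "edges = {{x, (par ^^ k) x} | x k. k \<in> {1, 2, 3}}"

lemma rel_sym: "rel k x y \<longleftrightarrow> rel k y x"
  by (auto simp: rel_def)

lemma edge_iff: "{x, y} \<in> edges \<longleftrightarrow> rel 1 x y \<or> rel 2 x y \<or> rel 3 x y"
proof -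
  have "{x, y} \<in> edges \<longleftrightarrow> (\<exists>k\<in>{1, 2, 3}. rel k x y)"
    unfolding edges_def rel_def mem_Collect_eq doubleton_eq_iff by blast
  then show ?thesis by simp
qed

lemma rel_lev: "rel k x y \<Longrightarrow> \<bar>lev x - lev y\<bar> = int k"
  by (auto simp: rel_def)

text \<open>
  How the unoriented graph determines \<open>par\<close>: an edge spans three generations iff the common neighbours
  of its ends form a clique. Once these edges are removed, the same criterion singles out the edges
  spanning two generations. The remaining edges form the tree, in which the parent of \<open>m\<close> is the
  only neighbour of \<open>m\<close> joined by two-generation edges to two others.
\<close>

lemma three_edge_iff:
  "rel 3 x y \<longleftrightarrow> {x, y} \<in> edges \<and>
     (\<forall>u v. u \<noteq> v \<longrightarrow> {u, x} \<in> edges \<longrightarrow> {u, y} \<in> edges \<longrightarrow> {v, x} \<in> edges \<longrightarrow> {v, y} \<in> edges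
        \<longrightarrow> {u, v} \<in> edges)" (is "?L x y \<longleftrightarrow> ?R x y")
proof
  have *: "?R x y" if "y = (par ^^ 3) x" for x y
  proof -
    have cn: "u = par x \<or> u = par (par x)" if "{u, x} \<in> edges" "{u, y} \<in> edges" for u
    proof -
      from that(1) have "\<exists>k\<in>{1,2,3}. u = (par ^^ k) x \<or> x = (par ^^ k) u"
        unfolding edge_iff rel_def by blast
      then consider k where "k \<in> {1,2,3}" "u = (par ^^ k) x"
        | k where "k \<in> {1,2,3}" "x = (par ^^ k) u" by blast
      then show ?thesis
      proof cases
        case 1
        with that(2) \<open>y = _\<close> show ?thesis
          by (auto simp: edge_iff numeral_eq_Suc dest!: rel_lev)
      next
        case 2
        with that(2) \<open>y = _\<close> show ?thesis
          by (auto simp: edge_iff dest!: rel_lev)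
      qed
    qed
    have "{x, y} \<in> edges" using that by (auto simp: edge_iff rel_def)
    moreover have "{par x, par (par x)} \<in> edges" "{par (par x), par x} \<in> edges"
      by (auto simp: edge_iff rel_def)
    ultimately show ?thesis by (metis cn)
  qed
  assume "?L x y"
  then consider "y = (par ^^ 3) x" | "x = (par ^^ 3) y" by (auto simp: rel_def)
  then show "?R x y"
  proof cases
    case 2
    from *[OF this] have r: "?R y x" .
    have "{x, y} \<in> edges" using conjunct1[OF r] by (simp add: insert_commute)
    then show ?thesis using r by blast
  qed (rule *)
next
  assume R: "?R x y"
  \<comment> \<open>For a span of one or two, the two children of the lower end are common
    neighbours on the same level, hence not adjacent.\<close>
  have no: False if "k = 1 \<or> k = 2" "b = (par ^^ k) a" "?R a b" for k a b
  proof -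
    obtain u v where uv: "u \<noteq> v" "par u = a" "par v = a" using two_children by blast
    have "{u, a} \<in> edges" "{v, a} \<in> edges" using uv by (auto simp: edge_iff rel_def)
    moreover have "{u, b} \<in> edges" "{v, b} \<in> edges" using uv that(1,2)
      by (auto simp: edge_iff rel_def numeral_eq_Suc)
    ultimately have "{u, v} \<in> edges" using uv that(3) by blast
    moreover have "lev u = lev v" using uv lev_par by (metis add.commute diff_add_cancel)
    ultimately show False by (auto simp: edge_iff dest!: rel_lev)
  qed
  have "{y, x} \<in> edges" using conjunct1[OF R] by (simp add: insert_commute)
  then have R': "?R y x" using R by blast
  show "?L x y"
    using R no[of 1 x y] no[of 2 x y] no[of 1 y x] no[of 2 y x] R R'
    unfolding edge_iff[of x y] rel_def by blast
qed

lemma two_edge_iff: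
  fixes adj2 defines "adj2 \<equiv> \<lambda>x y. {x, y} \<in> edges \<and> \<not> rel 3 x y"
  shows "rel 2 x y \<longleftrightarrow> adj2 x y \<and>
     (\<forall>u v. u \<noteq> v \<longrightarrow> adj2 u x \<longrightarrow> adj2 u y \<longrightarrow> adj2 v x \<longrightarrow> adj2 v y \<longrightarrow> adj2 u v)"
    (is "?L x y \<longleftrightarrow> ?R x y")
proof
  have a2: "adj2 x y \<longleftrightarrow> rel 1 x y \<or> rel 2 x y" for x y
    unfolding adj2_def edge_iff
    using rel_lev[of 1 x y] rel_lev[of 2 x y] rel_lev[of 3 x y] by auto
  have sym: "adj2 x y \<longleftrightarrow> adj2 y x" for x y by (auto simp: a2 rel_sym)
  {
    have *: "?R x y" if "y = (par ^^ 2) x" for x y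
    proof -
      have cn: "u = par x" if "adj2 u x" "adj2 u y" for u
      proof -
        from that(1) have "\<exists>k\<in>{1,2}. u = (par ^^ k) x \<or> x = (par ^^ k) u"
          unfolding a2 rel_def by blast
        then consider k where "k \<in> {1,2}" "u = (par ^^ k) x"
          | k where "k \<in> {1,2}" "x = (par ^^ k) u" by blast
        then show ?thesis
        proof cases
          case 1
          with that(2) \<open>y = _\<close> show ?thesis
            by (auto simp: a2 numeral_eq_Suc dest!: rel_lev)
        next
          case 2
          with that(2) \<open>y = _\<close> show ?thesis
            by (auto simp: a2 dest!: rel_lev)
        qed
      qed
      have "adj2 x y" using that by (auto simp: a2 rel_def)
      then show ?thesis by (metis cn)
    qed
    assume "?L x y"
    then consider "y = (par ^^ 2) x" | "x = (par ^^ 2) y" by (auto simp: rel_def)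
    then show "?R x y"
    proof cases
      case 2
      from *[OF this] have r: "?R y x" .
      have "adj2 x y" using conjunct1[OF r] sym by blast
      then show ?thesis using r by blast
    qed (rule *)
  next
    assume R: "?R x y"
    have no: False if "b = par a" "?R a b" for a b
    proof -
      obtain u v where uv: "u \<noteq> v" "par u = a" "par v = a" using two_children by blast
      have "adj2 u a" "adj2 v a" using uv by (auto simp: a2 rel_def)
      moreover have "adj2 u b" "adj2 v b" using uv that(1)
        by (auto simp: a2 rel_def numeral_eq_Suc)
      ultimately have "adj2 u v" using uv that(2) by blast
      moreover have "lev u = lev v" using uv lev_par by (metis add.commute diff_add_cancel)
      ultimately show False by (auto simp: a2 dest!: rel_lev)
    qed
    have "adj2 y x" using conjunct1[OF R] sym by blast
    then have R': "?R y x" using R by blast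
    have "rel 1 x y \<or> rel 2 x y" using R a2 by blast
    then show "?L x y"
      using no[OF _ R] no[OF _ R'] by (auto simp: rel_def)
  }
qed

lemma one_edge_iff: "rel 1 x y \<longleftrightarrow> {x, y} \<in> edges \<and> \<not> rel 2 x y \<and> \<not> rel 3 x y"
  unfolding edge_iff
  using rel_lev[of 1 x y] rel_lev[of 2 x y] rel_lev[of 3 x y] by auto

lemma parent_iff:
  "y = par m \<longleftrightarrow> rel 1 m y \<and>
     (\<exists>u v. u \<noteq> v \<and> rel 1 m u \<and> rel 1 m v \<and> rel 2 u y \<and> rel 2 v y)" (is "_ \<longleftrightarrow> ?R")
proof
  assume y: "y = par m"
  obtain u v where uv: "u \<noteq> v" "par u = m" "par v = m" using two_children by blast
  then show ?R using y
    by (intro conjI exI[of _ u] exI[of _ v]) (auto simp: rel_def numeral_eq_Suc)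
next
  assume R: ?R
  show "y = par m"
  proof (rule ccontr)
    assume "y \<noteq> par m"
    then have m: "m = par y" using R by (auto simp: rel_def)
    have "u = par m" if "rel 1 m u" "rel 2 u y" for u
    proof (rule ccontr)
      assume "u \<noteq> par m"
      then have "lev m = lev u - 1" using that(1) by (auto simp: rel_def)
      then show False using rel_lev[OF that(2)] m by simp
    qed
    then show False using R by metis
  qed
qed

section \<open>Automorphisms\<close>

lemma commute_par:
  assumes "bij g" and E: "\<And>x y. {g x, g y} \<in> edges \<longleftrightarrow> {x, y} \<in> edges"
  shows "g (par x) = par (g x)"
proof -
  \<comment> \<open>Reindexing quantifiers along \<open>g\<close> carries over each characterization
    in turn: they mention only adjacency and the spans already known to be preserved.\<close>
  have all: "(\<forall>u. P u) \<longleftrightarrow> (\<forall>u. P (g u))" for P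
    using \<open>bij g\<close> by (metis bij_pointE)
  have inj: "g x = g y \<longleftrightarrow> x = y" for x y
    using \<open>bij g\<close> by (meson bij_is_inj inj_eq)
  have r3: "rel 3 (g x) (g y) \<longleftrightarrow> rel 3 x y" for x y
    unfolding three_edge_iff by (subst all, subst (2) all) (simp only: E inj)
  have r2: "rel 2 (g x) (g y) \<longleftrightarrow> rel 2 x y" for x y
    unfolding two_edge_iff by (subst all, subst (2) all) (simp only: E inj r3)
  have r1: "rel 1 (g x) (g y) \<longleftrightarrow> rel 1 x y" for x y
    unfolding one_edge_iff by (simp only: E r2 r3)
  obtain u v where uv: "u \<noteq> v" "rel 1 x u" "rel 1 x v" "rel 2 u (par x)" "rel 2 v (par x)"
    and "rel 1 x (par x)"
    using parent_iff[of "par x" x] by auto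
  then have "rel 1 (g x) (g (par x)) \<and> (\<exists>u v. u \<noteq> v \<and> rel 1 (g x) u \<and> rel 1 (g x) v \<and>
      rel 2 u (g (par x)) \<and> rel 2 v (g (par x)))"
    using inj r1 r2 by (intro conjI exI[of _ "g u"] exI[of _ "g v"]) simp_all
  then show ?thesis by (simp add: parent_iff)
qed

lemma commute_anc:
  assumes "\<And>x. g (par x) = par (g x)"
  shows "g ((par ^^ n) x) = (par ^^ n) (g x)"
  using assms by (induction n) auto

lemma Aut_iff: "g \<in> Aut UNIV edges \<longleftrightarrow> bij g \<and> (\<forall>x. g (par x) = par (g x))"
proof
  assume "g \<in> Aut UNIV edges"
  then show "bij g \<and> (\<forall>x. g (par x) = par (g x))"
    using commute_par by (auto simp: Aut_def)
next
  assume g: "bij g \<and> (\<forall>x. g (par x) = par (g x))"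
  then have "rel k (g x) (g y) \<longleftrightarrow> rel k x y" for k x y
    unfolding rel_def by (metis bij_is_inj commute_anc inj_eq)
  then show "g \<in> Aut UNIV edges"
    using g by (auto simp: Aut_def edge_iff)
qed

text \<open>Every vertex shares an ancestor with \<open>0\<close>, and \<open>g\<close> preserves
  the numbers of generations to it, so the level shift at any vertex equals the shift at
  \<open>0\<close>.\<close>

lemma Aut_lev:
  assumes "g \<in> Aut UNIV edges"
  obtains s where "\<And>x. lev (g x) = lev x + s"
proof
  fix x
  obtain m n where mn: "(par ^^ m) x = (par ^^ n) 0" using common_ancestor by blast
  have "(par ^^ m) (g x) = (par ^^ n) (g 0)"
    using assms mn by (metis Aut_iff commute_anc)
  from arg_cong[OF this, of lev] arg_cong[OF mn, of lev]
  show "lev (g x) = lev x + (lev (g 0) - lev 0)" by simp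
qed

section \<open>Local finiteness, connectedness, transitivity and nonunimodularity\<close>

lemma adj_edges: "(x, y) \<in> adj edges \<longleftrightarrow> {x, y} \<in> edges"
  by (simp add: adj_def)

lemma sym_adj: "sym (adj E)"
  by (auto simp: adj_def sym_def insert_commute)

lemma graph_edges: "graph UNIV edges"
proof -
  have "x \<noteq> (par ^^ k) x" if "k \<in> {1,2,3}" for x k
  proof
    assume "x = (par ^^ k) x"
    then have "lev x = lev ((par ^^ k) x)" by (rule arg_cong)
    then show False using that by auto
  qed
  then show ?thesis unfolding graph_def edges_def by blast
qed

lemma desc_Suc: "{y. (par ^^ Suc n) y = x} = (\<Union>z\<in>{z. par z = x}. {y. (par ^^ n) y = z})"
  by auto

lemma finite_desc: "finite {y. (par ^^ n) y = x}"
proof (induction n arbitrary: x)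
  case (Suc n)
  then show ?case unfolding desc_Suc using finite_children by blast
qed auto

lemma card_desc: "card {y. (par ^^ n) y = x} = 2 ^ n"
proof (induction n arbitrary: x)
  case (Suc n)
  have "card {y. (par ^^ Suc n) y = x} = (\<Sum>z\<in>{z. par z = x}. card {y. (par ^^ n) y = z})"
    unfolding desc_Suc using finite_desc finite_children by (intro card_UN_disjoint) auto
  then show ?case using Suc card_children by simp
qed auto

lemma locally_finite_edges: "locally_finite UNIV edges"
  unfolding locally_finite_def
proof
  fix x
  have "{y. (x, y) \<in> adj edges} \<subseteq>
    (\<Union>k\<in>{1,2,3}. {(par ^^ k) x} \<union> {y. (par ^^ k) y = x})"
    by (auto simp: adj_edges edge_iff rel_def)
  then show "finite {y. (x, y) \<in> adj edges}"
    by (rule finite_subset) (use finite_desc in blast)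
qed

lemma connected_edges: "connected_graph UNIV edges"
proof -
  have up: "(x, (par ^^ n) x) \<in> (adj edges)\<^sup>*" for x n
  proof (induction n)
    case (Suc n)
    have "((par ^^ n) x, (par ^^ Suc n) x) \<in> adj edges"
      by (simp add: adj_edges edge_iff rel_def)
    then show ?case using Suc by (meson rtrancl.rtrancl_into_rtrancl)
  qed auto
  have "(x, y) \<in> (adj edges)\<^sup>*" for x y
  proof -
    obtain m n where "(par ^^ m) x = (par ^^ n) y" using common_ancestor by blast
    then show ?thesis
      using up[of x m] up[of y n] sym_rtrancl[OF sym_adj] by (metis rtrancl_trans symD)
  qed
  then show ?thesis by (auto simp: connected_graph_def component_def)
qed

lemma transitive_edges: "transitive_graph UNIV edges"
  unfolding transitive_graph_def
  using graph_edges locally_finite_edges connected_edges homogeneous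
  by (simp add: Aut_iff Bex_def conj_assoc)

text \<open>The stabilizer of a vertex fixes its parent, whereas the stabilizer of the parent can
  move the vertex to its sibling.\<close>

lemma not_unimodular_edges: "\<not> unimodular UNIV edges"
proof
  assume U: "unimodular UNIV edges"
  obtain u v where uv: "u \<noteq> v" "par u = par v"
    using two_children by metis
  have 1: "stab_orbit UNIV edges u (par u) \<subseteq> {par u}"
    by (auto simp: stab_orbit_def stabilizer_def Aut_iff)
  have sub: "stab_orbit UNIV edges (par u) u \<subseteq> {y. par y = par u}"
    by (auto simp: stab_orbit_def stabilizer_def Aut_iff)
  obtain g where g: "bij g" "\<And>z. g (par z) = par (g z)" "g u = v"
    using homogeneous by blast
  have "g \<in> stabilizer UNIV edges (par u)"
    using g uv by (metis (mono_tags, lifting) Aut_iff mem_Collect_eq stabilizer_def)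
  moreover have "id \<in> stabilizer UNIV edges (par u)"
    by (simp add: stabilizer_def Aut_iff)
  ultimately have "{u, v} \<subseteq> stab_orbit UNIV edges (par u) u"
    unfolding stab_orbit_def using g(3) imageI[of _ _ "\<lambda>g. g u"] by (metis empty_subsetI id_apply insert_subset)
  then have "2 \<le> card (stab_orbit UNIV edges (par u) u)"
    using card_mono[OF finite_subset[OF sub finite_children], of "{u, v}"] uv(1) by simp
  moreover have "card (stab_orbit UNIV edges u (par u)) \<le> 1"
    using card_mono[OF _ 1] by simp
  ultimately show False using U by (auto simp: unimodular_def)
qed

section \<open>Infinitely many ends\<close>

definition child :: "nat \<Rightarrow> nat" where "child x = (SOME y. par y = x)"

lemma par_child [simp]: "par (child x) = x"
  unfolding child_def using two_children by (metis (mono_tags) someI)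

lemma par_child_pow: "m \<le> n \<Longrightarrow> (par ^^ m) ((child ^^ n) x) = (child ^^ (n - m)) x"
proof (induction m arbitrary: n)
  case (Suc m)
  then obtain n' where "n = Suc n'" by (cases n) auto
  have "(par ^^ Suc m) ((child ^^ n) x) = (par ^^ m) (par ((child ^^ Suc n') x))"
    using \<open>n = _\<close> by (simp only: funpow_swap1 o_apply funpow.simps)
  then show ?case using Suc \<open>n = _\<close> by simp
qed auto

lemma lev_child_pow [simp]: "lev ((child ^^ n) x) = lev x + int n"
proof -
  have "lev ((par ^^ n) ((child ^^ n) x)) = lev x" by (simp add: par_child_pow)
  then show ?thesis by simp
qed

lemma ray_child: "ray UNIV edges (\<lambda>n. (child ^^ n) x)"
proof -
  have "inj (\<lambda>n. (child ^^ n) x)"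
    by (rule injI) (metis lev_child_pow add_left_cancel of_nat_eq_iff)
  then show ?thesis by (auto simp: ray_def adj_edges edge_iff rel_def)
qed

lemma end_rel_refl:
  assumes "ray V E r" shows "(r, r) \<in> end_rel V E"
  unfolding end_rel_def
proof (intro CollectI case_prodI conjI allI impI assms)
  fix S assume S: "finite S \<and> S \<subseteq> V"
  have "finite {n. r n \<in> S}"
    using S assms by (auto simp: ray_def intro: finite_imageD[of r] inj_on_subset
        finite_subset[of "r ` {n. r n \<in> S}" S])
  then obtain N where N: "\<And>n. r n \<in> S \<Longrightarrow> n < N"
    using finite_nat_set_iff_bounded by auto
  define D where "D = {e \<in> E. e \<inter> S = {}}"
  have step: "(r n, r (Suc n)) \<in> adj D" if "n \<ge> N" for n
    using assms that N[of n] N[of "Suc n"] by (auto simp: D_def adj_def ray_def)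
  have le: "(r m, r (m + k)) \<in> (adj D)\<^sup>*" if "m \<ge> N" for m k
  proof (induction k)
    case (Suc k)
    with step[of "m + k"] that show ?case by (auto intro: rtrancl.rtrancl_into_rtrancl)
  qed auto
  have "(r m, r n) \<in> (adj D)\<^sup>*" if "m \<ge> N" "n \<ge> N" for m n
    using le[of m "n - m"] le[of n "m - n"] that sym_rtrancl[OF sym_adj, of D]
    by (cases "m \<le> n") (auto dest: symD)
  then show "\<exists>N. \<forall>m\<ge>N. \<forall>n\<ge>N. r m \<notin> S \<and> r n \<notin> S \<and> r n \<in> component {e \<in> E. e \<inter> S = {}} (r m)"
    using N unfolding component_def D_def by (intro exI[of _ N]) fastforce
qed

text \<open>Edges span at most three generations, so deleting \<open>x\<close> and its two nearest
  ancestors cuts the proper descendants of \<open>x\<close> off from everything else. The ray below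
  an incomparable \<open>y\<close> never enters them.\<close>

lemma not_end_rel:
  assumes "\<And>n. (par ^^ n) y \<noteq> x" "\<And>n. (par ^^ n) x \<noteq> y"
  shows "(\<lambda>n. (child ^^ n) x, \<lambda>n. (child ^^ n) y) \<notin> end_rel UNIV edges"
proof
  define S where "S = {x, par x, par (par x)}"
  define D where "D = {e \<in> edges. e \<inter> S = {}}"
  assume "(\<lambda>n. (child ^^ n) x, \<lambda>n. (child ^^ n) y) \<in> end_rel UNIV edges"
  then have "\<exists>N. \<forall>m\<ge>N. \<forall>n\<ge>N. (child ^^ m) x \<notin> S \<and> (child ^^ n) y \<notin> S \<and>
      (child ^^ n) y \<in> component D ((child ^^ m) x)" if "finite S" "D = {e \<in> edges. e \<inter> S = {}}" for S D
    using that by (simp add: end_rel_def)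
  from this[OF _ D_def] obtain N where N: "\<And>m n. m \<ge> N \<Longrightarrow> n \<ge> N \<Longrightarrow>
      (child ^^ n) y \<in> component D ((child ^^ m) x)"
    using S_def by auto
  have inv: "\<exists>k\<ge>1. (par ^^ k) v = x" if "(u, v) \<in> (adj D)\<^sup>*" "\<exists>k\<ge>1. (par ^^ k) u = x" for u v
    using that
  proof (induction rule: rtrancl_induct)
    case (step v w)
    then obtain k where k: "k \<ge> 1" "(par ^^ k) v = x" by blast
    from step(2) have vw: "{v, w} \<in> edges" "w \<notin> S" by (auto simp: adj_def D_def)
    then have "\<exists>j\<in>{1,2,3}. w = (par ^^ j) v \<or> v = (par ^^ j) w"
      unfolding edge_iff rel_def by blast
    then consider j where "j \<in> {1,2,3}" "w = (par ^^ j) v" | j where "j \<in> {1,2,3}" "v = (par ^^ j) w"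
      by blast
    then show ?case
    proof cases
      case 1
      show ?thesis
      proof (cases "j < k")
        case True
        then have "(par ^^ (k - j)) w = x" using 1 k by (simp add: anc_add)
        then show ?thesis using True by (intro exI[of _ "k - j"]) auto
      next
        case False
        then have "w = (par ^^ (j - k)) x" using 1 k by (simp add: anc_add flip: k(2))
        moreover have "j - k \<in> {0,1,2}" using 1 k by auto
        ultimately have "w \<in> S" by (auto simp: S_def numeral_eq_Suc)
        then show ?thesis using vw by blast
      qed
    next
      case 2
      then show ?thesis using k by (intro exI[of _ "k + j"]) (auto simp: anc_add)
    qed
  qed auto
  have "((child ^^ Suc N) x, (child ^^ Suc N) y) \<in> (adj D)\<^sup>*"
    using N[of "Suc N" "Suc N"] by (simp add: component_def)
  moreover have "\<exists>k\<ge>1. (par ^^ k) ((child ^^ Suc N) x) = x"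
    by (intro exI[of _ "Suc N"]) (simp add: par_child_pow del: funpow.simps)
  ultimately obtain k where k: "(par ^^ k) ((child ^^ Suc N) y) = x" using inv by blast
  show False
  proof (cases "k \<le> Suc N")
    case True
    then have "(child ^^ (Suc N - k)) y = x" using k by (simp add: par_child_pow del: funpow.simps)
    from arg_cong[OF this, of "par ^^ (Suc N - k)"]
    show False using assms(2) by (auto simp: par_child_pow simp del: funpow.simps)
  next
    case False
    have "(par ^^ (k - Suc N)) y = (par ^^ (k - Suc N)) ((par ^^ Suc N) ((child ^^ Suc N) y))"
      by (simp add: par_child_pow del: funpow.simps)
    also have "\<dots> = x" using k False by (simp add: anc_add del: funpow.simps)
    finally show False using assms(1) by blast
  qed
qed

text \<open>The side branches of one descending ray start at pairwise incomparable vertices, so the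
  rays below them define distinct ends.\<close>

lemma infinite_ends: "infinite (ends UNIV edges)"
proof -
  obtain o2 where o2: "\<And>x. par (o2 x) = x" "\<And>x. o2 x \<noteq> child x"
  proof -
    have "\<exists>y. par y = x \<and> y \<noteq> child x" for x using two_children by metis
    then show ?thesis using that by metis
  qed
  define u where "u j = o2 ((child ^^ j) 0)" for j :: nat
  have lu: "lev (u j) = lev 0 + int j + 1" for j
    using lev_par[of "u j"] by (simp add: u_def o2 del: lev_par)
  have inc: "(par ^^ n) (u j) \<noteq> u i" if "i \<noteq> j" for i j n
  proof
    assume eq: "(par ^^ n) (u j) = u i"
    from arg_cong[OF this, of lev] have ij: "j = i + n" by (simp add: lu)
    with that obtain n' where n: "n = Suc n'" by (cases n) auto
    have "(par ^^ n) (u j) = (par ^^ n') ((child ^^ j) 0)"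
      by (simp add: n u_def funpow_swap1 o2)
    also have "\<dots> = child ((child ^^ i) 0)"
      using par_child_pow[of n' "i + n"] by (simp add: ij n)
    finally show False using eq o2 by (metis u_def)
  qed
  let ?r = "\<lambda>j n. (child ^^ n) (u j)"
  have "inj (\<lambda>j. end_rel UNIV edges `` {?r j})"
  proof (rule injI, rule ccontr)
    fix i j assume eq: "end_rel UNIV edges `` {?r i} = end_rel UNIV edges `` {?r j}" "i \<noteq> j"
    have "?r j \<in> end_rel UNIV edges `` {?r i}"
      unfolding eq(1) using end_rel_refl ray_child by blast
    then show False
      using not_end_rel[OF inc[OF eq(2)] inc[OF eq(2)[symmetric]]] by simp
  qed
  moreover have "range (\<lambda>j. end_rel UNIV edges `` {?r j}) \<subseteq> ends UNIV edges"
    by (auto simp: ends_def intro!: quotientI ray_child)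
  ultimately show ?thesis
    using finite_subset range_inj_infinite by blast
qed

end

section \<open>The spanning tree of a configuration\<close>

locale env = horo_tree +
  fixes c :: "nat \<Rightarrow> nat" and lab :: "int \<Rightarrow> nat"
begin

definition dom :: "nat \<Rightarrow> nat \<Rightarrow> bool" where
  "dom x d \<longleftrightarrow> (\<forall>k<d. c ((par ^^ Suc k) x) = (par ^^ k) x) \<and>
     (\<forall>k<d. lab (lev x - int k) \<le> lab (lev x - int d))"

text \<open>
  \<open>dom x d\<close> says that \<open>x\<close> is on the segment that the \<open>d\<close>-th ancestor of \<open>x\<close> would start, so \<open>idx x\<close> is
  the position of \<open>x\<close> on its segment, namely the largest such \<open>d\<close>.
\<close>

definition idx :: "nat \<Rightarrow> nat" where
  "idx x = (LEAST d. \<forall>e>d. \<not> dom x e)"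

text \<open>The attachment point of the segment with head \<open>t\<close>. If \<open>par t\<close>
  has odd index, its parent lies on the same segment at an even index, so the attachment point is
  always even.\<close>

definition ext :: "nat \<Rightarrow> nat" where
  "ext t = (if even (idx (par t)) then par t else par (par t))"

text \<open>
  \<open>nxt u\<close> is the neighbour of \<open>u\<close> in the spanning tree in the direction of the fixed end, and \<open>L\<close> is the
  label of the segment of \<open>u\<close>.
\<close>

definition nxt :: "nat \<Rightarrow> nat" where
  "nxt u = (let L = lab (lev u - int (idx u)) in
     if even (idx u) then
       if lab (lev u + 1) \<le> L then if lab (lev u + 2) \<le> L then c (c u) else c u
       else if idx u = 0 then ext u else par u
     else if idx u = 1 then ext (par u) else par (par u))"

text \<open>Intersecting with \<open>edges\<close> yields a set of edges of the graph for every
  configuration, hence a map into \<open>edge_subsets edges\<close> that is defined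
  everywhere.\<close>

definition ptree :: "nat set set" where
  "ptree = {{u, nxt u} | u. True} \<inter> edges"

end

text \<open>The almost sure properties on which the deterministic argument rests. As
  \<open>K\<close> is arbitrary in \<open>records\<close>, a record can stay maximal for far longer
  than it took to appear.\<close>

locale good_env = env +
  assumes par_c [simp]: "par (c x) = x"
    and unfavoured: "\<exists>n\<ge>m. c ((par ^^ Suc n) x) \<noteq> (par ^^ n) x"
    and records: "\<And>(m :: int) l K. \<exists>i A. m \<le> i \<and> l \<le> i \<and> i < l + int A \<and> (\<forall>j. l \<le> j \<and> j < i \<longrightarrow> lab j < lab i) \<and>
        (\<forall>j. i \<le> j \<and> j \<le> l + int (K * A) \<longrightarrow> lab j \<le> lab i)"
begin

section \<open>Segments of a good configuration\<close>

lemma dom_0 [simp]: "dom x 0" by (simp add: dom_def)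

lemma dom_bounded: "\<exists>n. \<forall>d>n. \<not> dom x d"
  using unfavoured[of 0 x] unfolding dom_def by blast

lemma dom_idx_and_max: "dom x (idx x) \<and> (\<forall>e>idx x. \<not> dom x e)"
proof -
  have m: "\<forall>e>idx x. \<not> dom x e"
    unfolding idx_def using LeastI_ex[OF dom_bounded] by blast
  moreover have "dom x (idx x)"
  proof (cases "idx x")
    case (Suc n)
    then have "\<not> (\<forall>e>n. \<not> dom x e)"
      using not_less_Least[of n "\<lambda>d. \<forall>e>d. \<not> dom x e"] by (simp add: idx_def)
    then show ?thesis using m Suc by (metis Suc_lessI)
  qed simp
  ultimately show ?thesis by blast
qed

lemmas dom_idx = dom_idx_and_max[THEN conjunct1]

lemma idx_ge: "dom x d \<Longrightarrow> d \<le> idx x"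
  using dom_idx_and_max by (meson not_le)

lemma idx_eqI: "dom x d \<Longrightarrow> (\<And>e. dom x e \<Longrightarrow> e \<le> d) \<Longrightarrow> idx x = d"
  using dom_idx idx_ge by (meson le_antisym)

definition head :: "nat \<Rightarrow> nat" where "head x = (par ^^ idx x) x"

lemma lev_head: "lev (head x) = lev x - int (idx x)" by (simp add: head_def)

lemma dom_anc: assumes "dom x (d + e)" shows "dom ((par ^^ d) x) e"
proof -
  have "c ((par ^^ Suc k) ((par ^^ d) x)) = (par ^^ k) ((par ^^ d) x) \<and>
     lab (lev ((par ^^ d) x) - int k) \<le> lab (lev ((par ^^ d) x) - int e)" if "k < e" for k
  proof -
    have "k + d < d + e" using that by simp
    with assms have "c ((par ^^ Suc (k + d)) x) = (par ^^ (k + d)) x"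
      "lab (lev x - int (k + d)) \<le> lab (lev x - int (d + e))"
      unfolding dom_def by blast+
    then show ?thesis unfolding anc_add lev_anc by (simp add: algebra_simps)
  qed
  then show ?thesis by (simp add: dom_def)
qed

text \<open>Overlapping runs combine: the head of the lower run lies on the upper run, so the label
  of the upper head bounds the label of the lower head and thereby all labels on the lower
  run.\<close>

lemma dom_trans:
  assumes x: "dom x i" and e: "dom ((par ^^ d) x) e" and de: "d \<le> i" "i \<le> d + e"
  shows "dom x (d + e)"
proof -
  have c: "c ((par ^^ Suc k) x) = (par ^^ k) x" if "k < d + e" for k
  proof (cases "k < d")
    case True
    then show ?thesis using x de by (simp add: dom_def)
  next
    case False
    then have "c ((par ^^ Suc (k - d)) ((par ^^ d) x)) = (par ^^ (k - d)) ((par ^^ d) x)"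
      using e that unfolding dom_def by simp
    then show ?thesis using False unfolding anc_add by simp
  qed
  have l1: "lab (lev x - int k) \<le> lab (lev x - int (d + e))" if "d \<le> k" "k \<le> d + e" for k
  proof (cases "k = d + e")
    case False
    then have "k - d < e" using that by simp
    then have "lab (lev ((par ^^ d) x) - int (k - d)) \<le> lab (lev ((par ^^ d) x) - int e)"
      using e unfolding dom_def by blast
    then show ?thesis using that by (simp add: of_nat_diff algebra_simps)
  qed simp
  have "lab (lev x - int k) \<le> lab (lev x - int (d + e))" if "k < d + e" for k
  proof (cases "k < d")
    case True
    then have "lab (lev x - int k) \<le> lab (lev x - int i)" using x de by (simp add: dom_def)
    then show ?thesis using l1[of i] de by simp
  qed (use l1 that in simp)
  with c show ?thesis by (simp add: dom_def)
qed

text \<open>A longer run through an ancestor on the segment would extend to \<open>x\<close> by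
  \<open>dom_trans\<close>. So the vertices between \<open>x\<close> and its head share that head,
  and segments are disjoint.\<close>

lemma idx_anc: assumes "d \<le> idx x" shows "idx ((par ^^ d) x) = idx x - d"
proof (rule idx_eqI)
  show "dom ((par ^^ d) x) (idx x - d)" using dom_anc[of x d "idx x - d"] dom_idx assms by simp
next
  fix e assume e: "dom ((par ^^ d) x) e"
  show "e \<le> idx x - d"
  proof (rule ccontr)
    assume "\<not> e \<le> idx x - d"
    then have "dom x (d + e)" using dom_trans[OF dom_idx e] assms by simp
    then show False using idx_ge \<open>\<not> e \<le> idx x - d\<close> by fastforce
  qed
qed

lemma head_anc: assumes "d \<le> idx x" shows "head ((par ^^ d) x) = head x"
  unfolding head_def idx_anc[OF assms] using assms by (simp add: anc_add)

lemma idx_head [simp]: "idx (head x) = 0" and head_head [simp]: "head (head x) = head x"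
  using idx_anc[of "idx x" x] head_anc[of "idx x" x] by (simp_all add: head_def)

lemma idx_par: "0 < idx x \<Longrightarrow> idx (par x) = idx x - 1"
  and head_par: "0 < idx x \<Longrightarrow> head (par x) = head x"
  using idx_anc[of 1 x] head_anc[of 1 x] by simp_all

lemma idx_par2: "1 < idx x \<Longrightarrow> idx (par (par x)) = idx x - 2"
  and head_par2: "1 < idx x \<Longrightarrow> head (par (par x)) = head x"
  using idx_anc[of 2 x] head_anc[of 2 x] by (simp_all add: numeral_eq_Suc)

lemma lev_c [simp]: "lev (c u) = lev u + 1"
  using lev_par[of "c u"] by simp

lemma idx_c:
  assumes "lab (lev u + 1) \<le> lab (lev u - int (idx u))"
  shows "idx (c u) = Suc (idx u)"
proof (rule idx_eqI)
  have "lab (lev (c u) - int k) \<le> lab (lev (c u) - int (Suc (idx u)))" if "k < Suc (idx u)" for k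
  proof (cases k)
    case (Suc k')
    then show ?thesis using that dom_idx[of u] by (simp add: dom_def)
  qed (use assms in simp)
  moreover have "c ((par ^^ Suc k) (c u)) = (par ^^ k) (c u)" if "k < Suc (idx u)" for k
  proof (cases k)
    case (Suc k')
    then have "c ((par ^^ Suc k') u) = (par ^^ k') u" using that dom_idx[of u] unfolding dom_def by simp
    then show ?thesis unfolding Suc by (simp only: funpow_Suc_right o_apply par_c)
  qed simp
  ultimately show "dom (c u) (Suc (idx u))" by (simp add: dom_def)
next
  fix e assume e: "dom (c u) e"
  show "e \<le> Suc (idx u)"
  proof (cases e)
    case (Suc e')
    then show ?thesis using dom_anc[of "c u" 1 e'] idx_ge[of u e'] e by simp
  qed simp
qed

lemma head_c:
  assumes "lab (lev u + 1) \<le> lab (lev u - int (idx u))"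
  shows "head (c u) = head u"
  using head_par[of "c u"] idx_c[OF assms] by simp

text \<open>\<open>len t\<close> is the last index of the segment with head \<open>t\<close>, one less than its number of vertices.\<close>

definition len :: "nat \<Rightarrow> nat" where
  "len t = (LEAST n. lab (lev t) < lab (lev t + int n + 1))"

lemma larger_label: "\<exists>n. lab i < lab (i + int n + 1)"
proof -
  obtain j A where "i + 1 \<le> j" "\<forall>k. i \<le> k \<and> k < j \<longrightarrow> lab k < lab j"
    using records[of "i + 1" i _] by blast
  then have "lab i < lab (i + int (nat (j - i - 1)) + 1)" by simp
  then show ?thesis by blast
qed

lemma len_max: "n < len t \<Longrightarrow> lab (lev t + int n + 1) \<le> lab (lev t)"
  unfolding len_def using not_less_Least by (metis not_less)

lemma len_less: "lab (lev t) < lab (lev t + int (len t) + 1)"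
  unfolding len_def using LeastI_ex[OF larger_label] .

lemma len_geI:
  assumes "\<And>j. lev t < j \<Longrightarrow> j \<le> lev t + int n \<Longrightarrow> lab j \<le> lab (lev t)"
  shows "n \<le> len t"
proof (rule ccontr)
  assume "\<not> n \<le> len t"
  then have "lab (lev t + int (len t) + 1) \<le> lab (lev t)" by (intro assms) auto
  then show False using len_less[of t] by simp
qed

lemma idx_le_len: "idx u \<le> len (head u)"
proof (rule len_geI)
  fix j assume j: "lev (head u) < j" "j \<le> lev (head u) + int (idx u)"
  define k where "k = nat (lev u - j)"
  have "k < idx u" "j = lev u - int k" using j by (auto simp: k_def lev_head)
  then show "lab j \<le> lab (lev (head u))" using dom_idx[of u] by (simp add: dom_def lev_head)
qed

lemma cont_iff: "lab (lev u + 1) \<le> lab (lev u - int (idx u)) \<longleftrightarrow> idx u < len (head u)"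
proof -
  have "lev (head u) + int (idx u) + 1 = lev u + 1" by (simp add: lev_head)
  then show ?thesis
    using len_max[of "idx u" "head u"] len_less[of "head u"] idx_le_len[of u]
    by (metis lev_head le_neq_implies_less not_less)
qed

lemma idx_c': "idx u < len (head u) \<Longrightarrow> idx (c u) = Suc (idx u)"
  and head_c': "idx u < len (head u) \<Longrightarrow> head (c u) = head u"
  using idx_c head_c cont_iff by blast+

text \<open>A segment continues exactly while the next label does not exceed that of its head, so
  the label tests in \<open>nxt\<close> compare positions with \<open>len\<close>.\<close>

lemma nxt_eq:
  "nxt u = (if even (idx u) then
       if idx u + 2 \<le> len (head u) then c (c u)
       else if idx u + 1 \<le> len (head u) then c u
       else if idx u = 0 then ext u else par u
     else if idx u = 1 then ext (par u) else par (par u))"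
proof (cases "idx u < len (head u)")
  case True
  then have "lab (lev u + 2) \<le> lab (lev u - int (idx u)) \<longleftrightarrow> idx u + 1 < len (head u)"
    using cont_iff[of "c u"] by (simp add: idx_c' head_c' add.commute)
  with True show ?thesis using cont_iff[of u] by (simp add: nxt_def Let_def) 
next
  case False
  then show ?thesis using cont_iff[of u] by (simp add: nxt_def Let_def)
qed

lemma head_ext [simp]: "head (ext t) = head (par t)" and even_ext [simp]: "even (idx (ext t))"
  by (auto simp: ext_def head_par idx_par elim: oddE)

text \<open>Decreases along the tree path within a segment.\<close>

definition key :: "nat \<Rightarrow> nat" where
  "key u = (if odd (idx u) then idx u else 2 * len (head u) + 2 - idx u)"

text \<open>The parity clauses say that the path turns from even to odd only at the bottom of the
  segment and then climbs by two, so that it skips no odd vertex.\<close>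

lemma nxt_cases:
  "nxt u = ext (head u) \<and> idx u \<le> 1 \<and> (even (idx u) \<longrightarrow> len (head u) = 0) \<or>
   head (nxt u) = head u \<and> key (nxt u) < key u \<and>
     (odd (idx u) \<longrightarrow> idx (nxt u) + 2 = idx u) \<and>
     (even (idx u) \<longrightarrow> even (idx (nxt u)) \<or> len (head u) \<le> Suc (idx (nxt u)))"
proof -
  have split: "(even i \<and> i + 2 \<le> n) \<or> (even i \<and> i + 1 = n) \<or> (even i \<and> i = n \<and> i = 0) \<or>
      (even i \<and> i = n \<and> 0 < i) \<or> i = 1 \<or> (odd i \<and> 3 \<le> i)" if "i \<le> n" for i n :: nat
    using that by presburger
  consider "even (idx u)" "idx u + 2 \<le> len (head u)" | "even (idx u)" "idx u + 1 = len (head u)"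
    | "even (idx u)" "idx u = len (head u)" "idx u = 0" | "even (idx u)" "idx u = len (head u)" "0 < idx u"
    | "idx u = 1" | "odd (idx u)" "3 \<le> idx u"
    using split[OF idx_le_len[of u]] by blast
  then show ?thesis
  proof cases
    case 1
    then have "idx (c (c u)) = idx u + 2" "head (c (c u)) = head u"
      by (simp_all add: idx_c' head_c')
    then show ?thesis using 1 by (simp add: nxt_eq key_def)
  next
    case 2
    then have "idx (c u) = Suc (idx u)" "head (c u) = head u" "len (head u) = Suc (idx u)"
      by (simp_all add: idx_c' head_c')
    then show ?thesis using 2(1) by (simp add: nxt_eq key_def)
  next
    case 3
    have "head u = u" using 3(3) by (simp add: head_def)
    moreover have "len (head u) = 0" using 3(2,3) by metis
    ultimately show ?thesis using 3(3) by (simp add: nxt_eq)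
  next
    case 4
    then have "idx (par u) = idx u - 1" "head (par u) = head u" "len (head u) = idx u"
      by (simp_all add: idx_par head_par)
    then show ?thesis using 4(1,3) by (simp add: nxt_eq key_def)
  next
    case 5
    have "head u = par u" using 5 by (simp add: head_def)
    then show ?thesis using 5 by (simp add: nxt_eq)
  next
    case 6
    then show ?thesis by (simp add: nxt_eq key_def idx_par2 head_par2)
  qed
qed

lemma nxt_edge: "{u, nxt u} \<in> edges"
proof -
  have e: "{u, par u} \<in> edges" "{u, par (par u)} \<in> edges" "{u, par (par (par u))} \<in> edges"
    "{u, c u} \<in> edges" "{u, c (c u)} \<in> edges" for u
    by (simp_all add: edge_iff rel_def numeral_eq_Suc)
  then show ?thesis unfolding nxt_eq ext_def by (simp split: if_splits)
qed

lemma ptree_eq: "ptree = {{u, nxt u} | u. True}"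
  unfolding ptree_def using nxt_edge by blast

section \<open>Paths towards the fixed end\<close>

definition reaches :: "nat \<Rightarrow> nat \<Rightarrow> bool" where
  "reaches u v \<longleftrightarrow> (\<exists>k. (nxt ^^ k) u = v)"

lemma reaches_refl [simp]: "reaches u u"
  unfolding reaches_def by (rule exI[of _ 0]) simp

lemma reaches_trans: "reaches u v \<Longrightarrow> reaches v w \<Longrightarrow> reaches u w"
  unfolding reaches_def by (metis funpow_add o_apply)

lemma reaches_nxt: "reaches u (nxt u)"
  unfolding reaches_def by (rule exI[of _ 1]) simp

lemma reaches_step: "reaches u v \<longleftrightarrow> u = v \<or> reaches (nxt u) v"
proof
  assume "reaches u v"
  then obtain k where k: "(nxt ^^ k) u = v" by (auto simp: reaches_def)
  show "u = v \<or> reaches (nxt u) v"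
  proof (cases k)
    case (Suc j)
    then have "(nxt ^^ j) (nxt u) = v" using k by (simp add: funpow_swap1)
    then show ?thesis by (auto simp: reaches_def)
  qed (use k in simp)
qed (use reaches_nxt reaches_trans in auto)

lemma reaches_exit: "\<exists>v. reaches u v \<and> head v = head u \<and> nxt v = ext (head u)"
proof (induction "key u" arbitrary: u rule: less_induct)
  case less
  show ?case
  proof (cases "nxt u = ext (head u)")
    case False
    then have "head (nxt u) = head u" "key (nxt u) < key u" using nxt_cases[of u] by auto
    then show ?thesis using less[of "nxt u"] reaches_step by metis
  qed (use reaches_refl in blast)
qed

lemma reaches_ext: "reaches u (ext (head u))"
  using reaches_exit reaches_step by (metis reaches_nxt reaches_trans)

lemma c_pow_idx: "(c ^^ idx u) (head u) = u"
proof -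
  have "(c ^^ d) ((par ^^ d) u) = u" if "d \<le> idx u" for d
    using that
  proof (induction d)
    case (Suc d)
    then have "c ((par ^^ Suc d) u) = (par ^^ d) u" using dom_idx[of u] by (auto simp: dom_def)
    then show ?case using Suc by (simp add: funpow_swap1)
  qed simp
  then show ?thesis by (simp add: head_def)
qed

lemma segment:
  assumes "head t = t" "j \<le> len t"
  shows "head ((c ^^ j) t) = t \<and> idx ((c ^^ j) t) = j"
  using assms(2)
proof (induction j)
  case 0
  then show ?case using idx_head[of t] assms(1) by simp
next
  case (Suc j)
  then show ?case by (simp add: idx_c' head_c')
qed

text \<open>Being even, or odd and not yet past position \<open>j\<close>, is an invariant of the
  path within the segment until it hits \<open>j\<close>, and the path cannot leave the segment
  before that.\<close>

lemma reaches_odd: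
  assumes "odd j" "j \<le> len (head u)" "even (idx u) \<or> j \<le> idx u"
  shows "reaches u ((c ^^ j) (head u))"
  using assms(3,2)
proof (induction "key u" arbitrary: u rule: less_induct)
  case less
  show ?case
  proof (cases "idx u = j")
    case True
    then show ?thesis using c_pow_idx[of u] by simp
  next
    case False
    from nxt_cases[of u] show ?thesis
    proof (elim disjE conjE)
      assume "idx u \<le> 1" "even (idx u) \<longrightarrow> len (head u) = 0"
      then show ?thesis using less.prems False \<open>odd j\<close>
        by (metis One_nat_def even_zero le_SucE le_zero_eq odd_pos less_one less_numeral_extra(3) linorder_not_less)
    next
      assume a: "head (nxt u) = head u" "key (nxt u) < key u"
        "odd (idx u) \<longrightarrow> idx (nxt u) + 2 = idx u"
        "even (idx u) \<longrightarrow> even (idx (nxt u)) \<or> len (head u) \<le> Suc (idx (nxt u))"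
      have "even (idx (nxt u)) \<or> j \<le> idx (nxt u)"
      proof (cases "even (idx u)")
        case True
        show ?thesis
        proof (rule ccontr)
          assume n: "\<not> ?thesis"
          then have "len (head u) \<le> Suc (idx (nxt u))" "idx (nxt u) < j" "odd (idx (nxt u))"
            using a True by auto
          then have "j = Suc (idx (nxt u))" using less.prems by simp
          then show False using \<open>odd (idx (nxt u))\<close> \<open>odd j\<close> by simp
        qed
      next
        case odd: False
        then have "j < idx u" using less.prems False by auto
        then have "j + 2 \<le> idx u" using odd \<open>odd j\<close>
          by (metis Suc_leI add_2_eq_Suc' even_Suc le_neq_implies_less)
        then show ?thesis using a odd by simp
      qed
      then have "reaches (nxt u) ((c ^^ j) (head (nxt u)))"
        using less.hyps[of "nxt u"] a less.prems by simp
      then show ?thesis using a(1) reaches_step by metis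
    qed
  qed
qed

text \<open>The exit from a segment lies on the segment of the parent of its head. So the path
  cannot jump over the segment of an ancestor, and it enters every new segment at an even
  vertex.\<close>

lemma reaches_segment:
  "head v = head ((par ^^ n) v) \<or>
   (\<exists>u. reaches v u \<and> head u = head ((par ^^ n) v) \<and> even (idx u))"
proof (induction n arbitrary: v rule: less_induct)
  case (less n)
  show ?case
  proof (cases "n \<le> idx v")
    case True
    then show ?thesis using head_anc by simp
  next
    case False
    define a where "a = (par ^^ n) v"
    define t where "t = head v"
    have t: "(par ^^ (n - idx v)) t = a"
      using False by (simp add: t_def head_def a_def anc_add)
    have r: "reaches v (ext t)" unfolding t_def by (rule reaches_ext)
    obtain d where d: "n - idx v = Suc d" using False by (metis Suc_diff_Suc not_le)
    have a: "a = (par ^^ d) (par t)" using t d by (simp add: funpow_swap1)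
    show ?thesis
    proof (cases "head (ext t) = head a")
      case True
      then show ?thesis using r even_ext unfolding a_def by blast
    next
      case ne: False
      have "\<exists>m<n. a = (par ^^ m) (ext t)"
      proof (cases "even (idx (par t))")
        case True
        then show ?thesis using a d by (intro exI[of _ d]) (auto simp: ext_def)
      next
        case odd: False
        \<comment> \<open>For \<open>d = 0\<close> the vertex \<open>a\<close> would be the parent
          of \<open>t\<close>, which has the same head as \<open>ext t\<close>, against
          \<open>ne\<close>.\<close>
        then obtain d' where "d = Suc d'" using ne a by (cases d) auto
        then show ?thesis using a d odd by (intro exI[of _ d']) (auto simp: ext_def funpow_swap1)
      qed
      then obtain m where m: "m < n" "a = (par ^^ m) (ext t)" by blast
      from less(1)[OF m(1), of "ext t"] ne show ?thesis
        unfolding m(2)[symmetric] a_def[symmetric] using r reaches_trans by blast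
    qed
  qed
qed

lemma head_nxt: "\<exists>k. head (nxt u) = (par ^^ k) (head u)"
proof -
  from nxt_cases[of u] consider "nxt u = ext (head u)" | "head (nxt u) = head u" by blast
  then show ?thesis
  proof cases
    case 1
    have "head (par (head u)) = (par ^^ Suc (idx (par (head u)))) (head u)"
      by (simp add: head_def[of "par (head u)"] funpow_swap1)
    then show ?thesis using 1 by (metis head_ext)
  next
    case 2
    then show ?thesis by (intro exI[of _ 0]) simp
  qed
qed

lemma reaches_head: "reaches z u \<Longrightarrow> \<exists>k. head u = (par ^^ k) (head z)"
proof -
  have "\<exists>m. head ((nxt ^^ k) z) = (par ^^ m) (head z)" for k
  proof (induction k)
    case 0
    show ?case by (intro exI[of _ 0]) simp
  next
    case (Suc k)
    then show ?case using head_nxt[of "(nxt ^^ k) z"] anc_add by (metis funpow.simps(2) o_apply)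
  qed
  then show "reaches z u \<Longrightarrow> ?thesis" by (auto simp: reaches_def)
qed

lemma reaches_head': "reaches z u \<Longrightarrow> \<exists>k. head u = (par ^^ k) z"
  using reaches_head[of z u] unfolding head_def[of z] anc_add by blast

section \<open>Acyclicity, connectedness and separating edges\<close>

definition below :: "nat \<Rightarrow> nat \<Rightarrow> bool" where
  "below v u \<longleftrightarrow> lev (head v) < lev (head u) \<or> (head v = head u \<and> key v < key u)"

text \<open>Leaving a segment lowers the level of the head, and a step within a segment lowers the
  key. So paths descend in this lexicographic order.\<close>

lemma below_nxt: "below (nxt u) u"
proof -
  from nxt_cases[of u] consider "nxt u = ext (head u)" | "head (nxt u) = head u" "key (nxt u) < key u"
    by blast
  then show ?thesis
  proof cases
    case 1
    then show ?thesis by (simp add: below_def lev_head[of "par (head u)"])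
  qed (simp add: below_def)
qed

lemma below_irrefl: "\<not> below u u" and below_trans: "below u v \<Longrightarrow> below v w \<Longrightarrow> below u w"
  by (auto simp: below_def)

lemma ptree_edge_iff: "{u, v} \<in> ptree \<longleftrightarrow> v = nxt u \<or> u = nxt v"
  unfolding ptree_eq by (auto simp: doubleton_eq_iff)

lemma inj_nxt_edge: "inj (\<lambda>u. {u, nxt u})"
proof (rule injI, rule ccontr)
  fix u v assume "{u, nxt u} = {v, nxt v}" "u \<noteq> v"
  then have "nxt u = v" "nxt v = u" by (auto simp: doubleton_eq_iff)
  then show False using below_nxt below_irrefl below_trans by metis
qed

text \<open>Both neighbours of a maximal vertex on a cycle would have to be its unique
  \<open>nxt\<close>, although they are distinct.\<close>

lemma no_cycle: "\<not> cycle ptree xs"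
proof
  assume c: "cycle ptree xs"
  define n where "n = length xs"
  have n: "3 \<le> n" and dist: "distinct xs"
    and adj: "\<And>i. i < n \<Longrightarrow> {xs ! i, xs ! (Suc i mod n)} \<in> ptree"
    using c by (auto simp: cycle_def adj_def n_def)
  have "\<exists>m\<in>set xs. \<forall>x\<in>set xs. x \<noteq> m \<longrightarrow> \<not> below m x"
    by (rule Finite_Set.bex_max_element)
      (use n below_irrefl below_trans in \<open>auto simp: n_def asymp_on_def transp_on_def\<close>)
  then obtain i where i: "i < n" and max: "\<And>j. j < n \<Longrightarrow> \<not> below (xs ! i) (xs ! j)"
    using below_irrefl by (metis in_set_conv_nth n_def)
  define p where "p = (if i = 0 then n - 1 else i - 1)"
  have p: "p < n" "Suc p mod n = i" using i n by (auto simp: p_def)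
  define s where "s = Suc i mod n"
  have s: "s < n" using n by (simp add: s_def)
  have "xs ! s = nxt (xs ! i)"
    using adj[OF i] below_nxt[of "xs ! s"] max[OF s] by (auto simp: ptree_edge_iff s_def)
  moreover have "xs ! p = nxt (xs ! i)"
    using adj[OF p(1)] below_nxt[of "xs ! p"] max[OF p(1)] by (auto simp: ptree_edge_iff p(2))
  ultimately have "s = p" using dist s p by (metis n_def nth_eq_iff_index_eq)
  then show False using i n unfolding s_def p_def
    by (cases "Suc i = n") (auto split: if_splits)
qed

lemma reaches_connected: "reaches u v \<Longrightarrow> (u, v) \<in> (adj ptree)\<^sup>*"
proof -
  have "(u, (nxt ^^ k) u) \<in> (adj ptree)\<^sup>*" for k
  proof (induction k)
    case (Suc k)
    have "((nxt ^^ k) u, (nxt ^^ Suc k) u) \<in> adj ptree"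
      by (simp add: adj_def ptree_edge_iff)
    then show ?case using Suc by (meson rtrancl.rtrancl_into_rtrancl)
  qed simp
  then show "reaches u v \<Longrightarrow> ?thesis" by (auto simp: reaches_def)
qed

text \<open>The paths from two vertices both pass the exit of the segment that contains a common
  ancestor.\<close>

lemma connected_ptree: "connected_graph UNIV ptree"
proof -
  have up: "(x, ext (head ((par ^^ n) x))) \<in> (adj ptree)\<^sup>*" for x n
    using reaches_segment[of x n] reaches_ext reaches_connected by (metis reaches_trans)
  have "(x, y) \<in> (adj ptree)\<^sup>*" for x y
  proof -
    obtain m n where "(par ^^ m) x = (par ^^ n) y" using common_ancestor by blast
    then show ?thesis
      using up[of x m] up[of y n] sym_rtrancl[OF sym_adj] by (metis rtrancl_trans symD)
  qed
  then show ?thesis by (auto simp: connected_graph_def component_def)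
qed

lemma spanning_tree_ptree: "spanning_tree UNIV edges ptree"
proof -
  have "ptree \<subseteq> edges" by (simp add: ptree_def)
  then show ?thesis
    using graph_edges connected_ptree no_cycle
    by (auto simp: spanning_tree_def tree_def graph_def)
qed

text \<open>Whether a vertex reaches \<open>u\<close> does not change along any tree edge other than
  \<open>{u, nxt u}\<close>.\<close>

lemma separates:
  assumes "reaches y u \<noteq> reaches x u"
  shows "{u, nxt u} \<in> ptree" "y \<notin> component (ptree - {{u, nxt u}}) x"
proof -
  show "{u, nxt u} \<in> ptree" by (auto simp: ptree_eq)
  have eq: "reaches z u = reaches x u" if "(x, z) \<in> (adj (ptree - {{u, nxt u}}))\<^sup>*" for z
    using that
  proof (induction rule: rtrancl_induct)
    case (step v w)
    then have "{v, w} \<in> ptree" "{v, w} \<noteq> {u, nxt u}" by (auto simp: adj_def)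
    then have "reaches v u = reaches w u"
      using reaches_step[of v u] reaches_step[of w u]
      by (auto simp: ptree_edge_iff doubleton_eq_iff)
    then show ?case using step by simp
  qed simp
  then show "y \<notin> component (ptree - {{u, nxt u}}) x"
    using assms eq[of y] unfolding component_def by blast
qed

end

section \<open>Cut sets of small weight\<close>

text \<open>A finite certificate, via the union bound, that percolation on \<open>T\<close> with
  parameter \<open>p\<close> joins \<open>x\<close> to a vertex outside \<open>D\<close> with
  probability at most \<open>\<epsilon>\<close>: each such vertex requires all edges of some
  \<open>U\<close> to be open.\<close>

definition cut_family :: "nat set set \<Rightarrow> nat set set \<Rightarrow> nat \<Rightarrow> real \<Rightarrow> real \<Rightarrow> nat set \<Rightarrow> nat set set set \<Rightarrow> bool" where
  "cut_family E T x p \<epsilon> D \<U> \<longleftrightarrow> finite D \<and> finite \<U> \<and> (\<forall>U\<in>\<U>. finite U \<and> U \<subseteq> E) \<and>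
     (\<Sum>U\<in>\<U>. p ^ card U) \<le> \<epsilon> \<and>
     (\<forall>y. y \<notin> D \<longrightarrow> (\<exists>U\<in>\<U>. \<forall>e\<in>U. e \<in> T \<and> y \<notin> component (T - {e}) x))"

context good_env
begin

lemma idx_le_unfavoured:
  assumes "(par ^^ m) v = t" "c (par t) \<noteq> t"
  shows "idx v \<le> m"
proof (rule ccontr)
  assume "\<not> idx v \<le> m"
  then have "c ((par ^^ Suc m) v) = (par ^^ m) v"
    using dom_idx[of v] unfolding dom_def by (meson not_le)
  then show False using assms by simp
qed

lemma head_eq_self: "idx t = 0 \<Longrightarrow> head t = t"
  by (simp add: head_def)

text \<open>An ancestor that is not the favourite of its parent is a head, and the path from
  \<open>x\<close> meets its segment. The path from \<open>y\<close> meets only segments whose heads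
  are ancestors of \<open>y\<close>, so it avoids all the chosen ones unless \<open>y\<close>
  descends from the highest.\<close>

lemma upper_cut:
  assumes F: "finite F" "\<And>n. n \<in> F \<Longrightarrow> c ((par ^^ Suc n) x) \<noteq> (par ^^ n) x"
  obtains U where "finite U" "U \<subseteq> edges" "card U = card F"
    "\<And>y n. n \<in> F \<Longrightarrow> \<forall>m\<in>F. m \<le> n \<Longrightarrow> \<forall>k. (par ^^ k) y \<noteq> (par ^^ n) x \<Longrightarrow>
      \<forall>e\<in>U. e \<in> ptree \<and> y \<notin> component (ptree - {e}) x"
proof -
  have head: "head ((par ^^ n) x) = (par ^^ n) x" if "n \<in> F" for n
    using idx_le_unfavoured[of 0 "(par ^^ n) x" "(par ^^ n) x"] F(2)[OF that]
    by (intro head_eq_self) simp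
  have "\<exists>u. reaches x u \<and> head u = (par ^^ n) x" if "n \<in> F" for n
    using reaches_segment[of x n] head[OF that] reaches_refl by metis
  then obtain u where u: "\<And>n. n \<in> F \<Longrightarrow> reaches x (u n) \<and> head (u n) = (par ^^ n) x"
    by metis
  have inj: "inj_on u F"
  proof (rule inj_onI)
    fix m n assume "m \<in> F" "n \<in> F" "u m = u n"
    then have "(par ^^ m) x = (par ^^ n) x" using u by metis
    from arg_cong[OF this, of lev] show "m = n" by simp
  qed
  let ?U = "(\<lambda>v. {v, nxt v}) ` u ` F"
  show ?thesis
  proof
    show "finite ?U" using F by simp
    show "?U \<subseteq> edges" using nxt_edge by blast
    have "card ?U = card (u ` F)"
      by (intro card_image inj_on_subset[OF inj_nxt_edge]) simp
    then show "card ?U = card F" using card_image[OF inj] by simp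
    fix y n assume n: "n \<in> F" "\<forall>m\<in>F. m \<le> n" and y: "\<forall>k. (par ^^ k) y \<noteq> (par ^^ n) x"
    have "reaches y (u m) \<noteq> reaches x (u m)" if m: "m \<in> F" for m
    proof -
      have "\<not> reaches y (u m)"
      proof
        assume "reaches y (u m)"
        then obtain k where "(par ^^ m) x = (par ^^ k) y" using reaches_head' u[OF m] by metis
        then have "(par ^^ (n - m)) ((par ^^ m) x) = (par ^^ (n - m)) ((par ^^ k) y)" by simp
        then have "(par ^^ n) x = (par ^^ (n - m + k)) y" using n m by (simp add: anc_add)
        then show False using y by metis
      qed
      then show ?thesis using u[OF m] by simp
    qed
    then show "\<forall>e\<in>?U. e \<in> ptree \<and> y \<notin> component (ptree - {e}) x"
      using separates by blast
  qed
qed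

text \<open>
  A segment whose head \<open>w\<close> is not an ancestor of \<open>x\<close> has to be traversed from \<open>x\<close> along all its odd
  vertices, unless the target lies on the segment itself.
\<close>

lemma lower_cut:
  assumes w: "(par ^^ \<delta>) b = w" "idx w = 0" "lev x < lev w"
    and n: "head b = w \<Longrightarrow> 2 * n \<le> \<delta>" "head b \<noteq> w \<Longrightarrow> 2 * n \<le> len w"
  obtains U where "finite U" "U \<subseteq> edges" "card U = n"
    "\<And>y m. (par ^^ m) y = b \<Longrightarrow> \<forall>e\<in>U. e \<in> ptree \<and> y \<notin> component (ptree - {e}) x"
proof -
  have hw: "head w = w" using w by (simp add: head_eq_self)
  define v where "v k = (c ^^ (2 * k + 1)) w" for k
  have idx: "idx y = k" if "head y = w" "(par ^^ k) y = w" for y k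
  proof -
    have "lev w = lev y - int (idx y)" using lev_head[of y] that(1) by simp
    moreover have "lev w = lev y - int k" using that(2) lev_anc by metis
    ultimately show ?thesis by simp
  qed
  have len: "2 * n \<le> len w"
  proof (cases "head b = w")
    case True
    then have "\<delta> \<le> len w" using idx[OF True w(1)] idx_le_len[of b] by simp
    then show ?thesis using n(1)[OF True] by simp
  qed (use n in simp)
  have v: "head (v k) = w \<and> idx (v k) = 2 * k + 1" if "k < n" for k
    unfolding v_def using segment[OF hw, of "2 * k + 1"] that len by simp
  have inj: "inj_on v {..<n}"
  proof (rule inj_onI)
    fix k l assume "k \<in> {..<n}" "l \<in> {..<n}" "v k = v l"
    then have "idx (v k) = 2 * k + 1" "idx (v k) = 2 * l + 1"
      using v[of k] v[of l] by (metis lessThan_iff)+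
    then show "k = l" by simp
  qed
  let ?U = "(\<lambda>v. {v, nxt v}) ` v ` {..<n}"
  show ?thesis
  proof
    show "finite ?U" by simp
    show "?U \<subseteq> edges" using nxt_edge by blast
    have "card ?U = card (v ` {..<n})"
      by (intro card_image inj_on_subset[OF inj_nxt_edge]) simp
    then show "card ?U = n" using card_image[OF inj] by simp
    fix y m assume y: "(par ^^ m) y = b"
    have yw: "(par ^^ (\<delta> + m)) y = w" using y w(1) anc_add by metis
    have "reaches y (v k) \<noteq> reaches x (v k)" if k: "k < n" for k
    proof -
      have len': "2 * k + 1 \<le> len w" using k len by simp
      have via: "reaches y (v k)" if "reaches y u" "head u = w" "even (idx u)" for u
        using reaches_odd[of "2 * k + 1" u] that len' reaches_trans by (auto simp: v_def)
      \<comment> \<open>If \<open>y\<close> lies on the segment of \<open>w\<close>, then so does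
        \<open>b\<close>, and \<open>y\<close> is at a position beyond the chosen odd vertices.
        Otherwise the path from \<open>y\<close> enters the segment at an even vertex and meets all
        odd ones.\<close>
      have "reaches y (v k)"
      proof (cases "head b = w")
        case True
        show ?thesis
        proof (cases "head y = w")
          case yh: True
          have "idx y = \<delta> + m" by (rule idx[OF yh yw])
          then have "2 * k + 1 \<le> idx y" using n(1)[OF True] k by simp
          then show ?thesis using reaches_odd[of "2 * k + 1" y] yh len' by (simp add: v_def)
        next
          case False
          then show ?thesis using reaches_segment[of y m] y True via by metis
        qed
      next
        case False
        have "head y \<noteq> w"
        proof
          assume h: "head y = w"
          have "m \<le> idx y" using idx[OF h yw] by simp
          then show False using head_anc[of m y] y h False by simp
        qed
        then show ?thesis using reaches_segment[of y "\<delta> + m"] yw hw via by metis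
      qed
      moreover have "\<not> reaches x (v k)"
      proof
        assume "reaches x (v k)"
        then obtain j where "w = (par ^^ j) x" using reaches_head' v[OF k] by metis
        from arg_cong[OF this, of lev] show False using w(3) by simp
      qed
      ultimately show ?thesis by simp
    qed
    then show "\<forall>e\<in>?U. e \<in> ptree \<and> y \<notin> component (ptree - {e}) x"
      using separates by blast
  qed
qed

text \<open>Counting against weight: there are up to \<open>2 ^ n\<close> cuts, and every block of
  \<open>s\<close> edges in a cut contributes a factor of at most \<open>1 / 4\<close>.\<close>

lemma power_le_half:
  fixes p :: real
  assumes "0 \<le> p" "p ^ s \<le> 1 / 4" "n \<le> A * k"
  shows "2 ^ n * p ^ (s * (A * k)) \<le> (1 / 2) ^ (A * k)"
proof -
  have "2 ^ n * p ^ (s * (A * k)) \<le> 2 ^ (A * k) * (1 / 4) ^ (A * k)"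
    unfolding power_mult[of p s] using assms
    by (intro mult_mono power_increasing power_mono) auto
  also have "\<dots> = (2 * (1 / 4)) ^ (A * k)" by (simp only: power_mult_distrib)
  also have "\<dots> = (1 / 2) ^ (A * k)" by simp
  finally show ?thesis .
qed

lemma ex_cut_family:
  assumes p: "0 < p" "p < 1" and "0 < \<epsilon>"
  shows "\<exists>D \<U>. cut_family edges ptree x p \<epsilon> D \<U>"
proof -
  \<comment> \<open>Half of \<open>\<epsilon>\<close> is allotted to the one upper cut, the other
    half to the lower cuts, whose total weight will be at most
    \<open>2 * (1 / 2) ^ A0\<close>.\<close>
  obtain M0 where M0: "p ^ M0 < \<epsilon> / 2" using real_arch_pow_inv[of "\<epsilon> / 2" p] assms by auto
  define M where "M = Suc M0"
  have "p ^ M \<le> p ^ M0" by (rule power_decreasing) (use p in \<open>auto simp: M_def\<close>)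
  with M0 have M: "p ^ M \<le> \<epsilon> / 2" by linarith
  obtain s where s: "p ^ s \<le> 1 / 4" using real_arch_pow_inv[of "1 / 4" p] p less_imp_le by auto
  obtain A0 where A0: "(1 / 2) ^ A0 < \<epsilon> / 4"
    using real_arch_pow_inv[of "\<epsilon> / 4" "1 / 2"] assms by auto
  have "infinite {n. c ((par ^^ Suc n) x) \<noteq> (par ^^ n) x}"
    unfolding infinite_nat_iff_unbounded_le using unfavoured[of _ x] by blast
  from infinite_arbitrarily_large[OF this, of M] obtain F where F: "finite F" "card F = M"
    and sub: "F \<subseteq> {n. c ((par ^^ Suc n) x) \<noteq> (par ^^ n) x}" by blast
  have F': "c ((par ^^ Suc n) x) \<noteq> (par ^^ n) x" if "n \<in> F" for n
    using subsetD[OF sub that] by simp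
  have "F \<noteq> {}" using F(2) by (auto simp: M_def)
  define n0 where "n0 = Max F"
  have n0: "n0 \<in> F" "\<forall>m\<in>F. m \<le> n0" using F(1) \<open>F \<noteq> {}\<close> by (simp_all add: n0_def)
  \<comment> \<open>As \<open>a\<close> is not the favourite of its parent, no segment that starts
    above \<open>a\<close> contains it.\<close>
  define a where "a = (par ^^ n0) x"
  have una: "c (par a) \<noteq> a" using F'[OF n0(1)] by (simp add: a_def)
  obtain U0 where U0: "finite U0" "U0 \<subseteq> edges" "card U0 = M"
    "\<And>y. \<forall>k. (par ^^ k) y \<noteq> a \<Longrightarrow> \<forall>e\<in>U0. e \<in> ptree \<and> y \<notin> component (ptree - {e}) x"
  proof (rule upper_cut[OF F(1) F'])
    fix U assume "finite U" "U \<subseteq> edges" "card U = card F" and U: "\<And>y n. n \<in> F \<Longrightarrow> \<forall>m\<in>F. m \<le> n \<Longrightarrow>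
      \<forall>k. (par ^^ k) y \<noteq> (par ^^ n) x \<Longrightarrow> \<forall>e\<in>U. e \<in> ptree \<and> y \<notin> component (ptree - {e}) x"
    then show ?thesis using that[of U] U[OF n0] F(2) by (simp add: a_def)
  qed

  define l where "l = lev a"
  \<comment> \<open>With this \<open>K\<close>, the lengths \<open>K * A\<close> and
    \<open>K * K * A\<close> exceed \<open>A\<close> by exactly \<open>2 * (s * A)\<close> and
    \<open>2 * (s * (A * (K + 1)))\<close>, twice the two cut sizes used in \<open>n\<close>
    below.\<close>
  define K where "K = 2 * s + 1"
  \<comment> \<open>The record level is deeper than \<open>x\<close>, so the heads found there are
    not ancestors of \<open>x\<close>. It is at least \<open>A0\<close> levels below
    \<open>a\<close>, which gives \<open>A0 < A\<close>.\<close>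
  obtain i A where i: "max (lev x + 1) (l + int A0) \<le> i" "l \<le> i" "i < l + int A"
    and less: "\<And>j. l \<le> j \<Longrightarrow> j < i \<Longrightarrow> lab j < lab i"
    and le: "\<And>j. i \<le> j \<Longrightarrow> j \<le> l + int (K * K * A) \<Longrightarrow> lab j \<le> lab i"
    using records[of "max (lev x + 1) (l + int A0)" l "K * K"] by metis
  define h where "h = nat (i - l)"
  have h: "i = l + int h" "h < A" "A0 < A" using i by (auto simp: h_def)
  have KA: "K * A = 2 * (s * A) + A" "K * K * A = 2 * (s * (A * (K + 1))) + A"
    by (simp_all add: K_def algebra_simps)
  define \<delta> where "\<delta> = K * A - h"
  have \<delta>: "h + \<delta> = K * A" "2 * (s * A) \<le> \<delta>" using h KA by (auto simp: \<delta>_def)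
  define w where "w b = (par ^^ \<delta>) b" for b
  define Bs where "Bs = {b. (par ^^ (K * A)) b = a}"
  have Bs: "finite Bs" "card Bs = 2 ^ (K * A)" by (simp_all add: Bs_def finite_desc card_desc)
  have wa: "(par ^^ h) (w b) = a" if "b \<in> Bs" for b
    using that \<delta> by (simp add: Bs_def w_def anc_add)
  have lw: "lev (w b) = i" if "b \<in> Bs" for b
    using arg_cong[OF wa[OF that], of lev] h(1) by (simp add: l_def)
  \<comment> \<open>No segment enters \<open>a\<close> from above, and the labels from level
    \<open>l\<close> to just before the record are strictly smaller, so every descendant of
    \<open>a\<close> on the record level starts a segment.\<close>
  have iw: "idx (w b) = 0" if b: "b \<in> Bs" for b
  proof (rule ccontr)
    assume pos: "idx (w b) \<noteq> 0"
    have "idx (w b) \<le> h" by (rule idx_le_unfavoured[OF wa[OF b] una])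
    then have "lab (lev (w b) - int (idx (w b))) < lab i"
      using pos lw[OF b] h by (intro less) auto
    moreover have "lab (lev (w b) - int 0) \<le> lab (lev (w b) - int (idx (w b)))"
      using dom_idx[of "w b"] pos unfolding dom_def by blast
    ultimately show False using lw[OF b] by simp
  qed
  have lenw: "2 * (s * (A * (K + 1))) \<le> len (w b)" if b: "b \<in> Bs" for b
  proof (rule len_geI)
    fix j assume "lev (w b) < j" "j \<le> lev (w b) + int (2 * (s * (A * (K + 1))))"
    then show "lab j \<le> lab (lev (w b))"
      unfolding lw[OF b] using h KA by (intro le) auto
  qed
  \<comment> \<open>If \<open>b\<close> is on the segment of \<open>w b\<close>, only the odd
    vertices between the two are sure to be crossed; otherwise the detour through the whole segment
    is available.\<close>
  define n where "n b = (if head b = w b then s * A else s * (A * (K + 1)))" for b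
  have "\<exists>U. finite U \<and> U \<subseteq> edges \<and> card U = n b \<and>
      (\<forall>y m. (par ^^ m) y = b \<longrightarrow> (\<forall>e\<in>U. e \<in> ptree \<and> y \<notin> component (ptree - {e}) x))"
    if b: "b \<in> Bs" for b
  proof -
    have x: "lev x < lev (w b)" using lw[OF b] i by simp
    have wb: "(par ^^ \<delta>) b = w b" by (simp add: w_def)
    have n: "head b = w b \<Longrightarrow> 2 * n b \<le> \<delta>" "head b \<noteq> w b \<Longrightarrow> 2 * n b \<le> len (w b)"
      using \<delta>(2) lenw[OF b] by (simp_all add: n_def)
    show ?thesis
      by (rule lower_cut[OF wb iw[OF b] x n]) blast+
  qed
  then obtain U where U: "\<And>b. b \<in> Bs \<Longrightarrow> finite (U b) \<and> U b \<subseteq> edges \<and> card (U b) = n b \<and>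
      (\<forall>y m. (par ^^ m) y = b \<longrightarrow> (\<forall>e\<in>U b. e \<in> ptree \<and> y \<notin> component (ptree - {e}) x))"
    by metis
  define D where "D = (\<Union>k<K * A. {y. (par ^^ k) y = a})"
  have "cut_family edges ptree x p \<epsilon> D (insert U0 (U ` Bs))"
    unfolding cut_family_def
  proof (intro conjI allI impI)
    show "finite D" unfolding D_def using finite_desc by blast
    show "finite (insert U0 (U ` Bs))" using Bs by simp
    show "\<forall>V\<in>insert U0 (U ` Bs). finite V \<and> V \<subseteq> edges" using U0 U by auto
  next
    \<comment> \<open>A segment has only one vertex at the depth of \<open>Bs\<close>, so the
      \<open>b\<close> with the small cut number at most \<open>2 ^ h\<close>, one for each
      head.\<close>
    define H where "H = {b \<in> Bs. head b = w b}"
    have "card H \<le> card {v. (par ^^ h) v = a}"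
    proof (rule card_inj_on_le)
      show "w ` H \<subseteq> {v. (par ^^ h) v = a}" using wa by (auto simp: H_def)
      show "finite {v. (par ^^ h) v = a}" by (rule finite_desc)
      show "inj_on w H"
      proof (rule inj_onI)
        fix b b' assume b: "b \<in> H" "b' \<in> H" "w b = w b'"
        have "(c ^^ \<delta>) (w b) = b" if "b \<in> H" for b
        proof -
          have "head b = w b" using that by (simp add: H_def)
          moreover have "idx b = \<delta>"
            using arg_cong[OF calculation, of lev] by (simp add: lev_head w_def)
          ultimately show ?thesis using c_pow_idx[of b] by simp
        qed
        then show "b = b'" using b by metis
      qed
    qed
    then have H: "real (card H) \<le> 2 ^ h"
      unfolding card_desc by (metis of_nat_le_iff of_nat_numeral of_nat_power)
    have "(\<Sum>b\<in>Bs. p ^ card (U b)) = (\<Sum>b\<in>Bs. p ^ n b)"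
      by (rule sum.cong) (use U in auto)
    also have "\<dots> = (\<Sum>b\<in>H. p ^ n b) + (\<Sum>b\<in>Bs - H. p ^ n b)"
      using Bs by (subst sum.subset_diff[of H Bs]) (auto simp: H_def)
    also have "(\<Sum>b\<in>H. p ^ n b) = card H * p ^ (s * (A * 1))"
      by (simp add: H_def n_def)
    also have "(\<Sum>b\<in>Bs - H. p ^ n b) = card (Bs - H) * p ^ (s * (A * (K + 1)))"
      by (simp add: H_def n_def)
    also have "card H * p ^ (s * (A * 1)) \<le> 2 ^ h * p ^ (s * (A * 1))"
      using H p by (intro mult_right_mono) auto
    also have "\<dots> \<le> (1 / 2) ^ (A * 1)"
      using h p s by (intro power_le_half) auto
    also have "card (Bs - H) * p ^ (s * (A * (K + 1))) \<le> 2 ^ (K * A) * p ^ (s * (A * (K + 1)))"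
    proof -
      have "card (Bs - H) \<le> 2 ^ (K * A)" using card_mono[of Bs "Bs - H"] Bs by auto
      then have "real (card (Bs - H)) \<le> 2 ^ (K * A)"
        by (metis of_nat_le_iff of_nat_numeral of_nat_power)
      then show ?thesis using p by (intro mult_right_mono) auto
    qed
    also have "\<dots> \<le> (1 / 2) ^ (A * (K + 1))"
      using p s by (intro power_le_half) (auto simp: algebra_simps)
    also have "(1 / 2) ^ (A * (K + 1)) \<le> (1 / 2 :: real) ^ (A * 1)"
      by (intro power_decreasing) auto
    finally have "(\<Sum>b\<in>Bs. p ^ card (U b)) \<le> 2 * (1 / 2) ^ A" by simp
    also have "\<dots> \<le> 2 * (1 / 2) ^ A0"
      using h by (intro mult_left_mono power_decreasing) auto
    also have "\<dots> \<le> \<epsilon> / 2" using A0 by simp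
    finally have sum: "(\<Sum>b\<in>Bs. p ^ card (U b)) \<le> \<epsilon> / 2" .
    have "(\<Sum>V\<in>insert U0 (U ` Bs). p ^ card V) \<le> p ^ card U0 + (\<Sum>V\<in>U ` Bs. p ^ card V)"
      using Bs p by (simp add: sum.insert_if)
    also have "(\<Sum>V\<in>U ` Bs. p ^ card V) \<le> (\<Sum>b\<in>Bs. p ^ card (U b))"
      using sum_image_le[of Bs "\<lambda>V. p ^ card V" U] Bs p by simp
    finally show "(\<Sum>V\<in>insert U0 (U ` Bs). p ^ card V) \<le> \<epsilon>"
      using sum M U0(3) by simp
  next
    fix y assume y: "y \<notin> D"
    show "\<exists>V\<in>insert U0 (U ` Bs). \<forall>e\<in>V. e \<in> ptree \<and> y \<notin> component (ptree - {e}) x"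
    proof (cases "\<exists>k. (par ^^ k) y = a")
      case True
      then obtain k where k: "(par ^^ k) y = a" by blast
      then have "K * A \<le> k" using y by (auto simp: D_def not_less)
      then have b: "(par ^^ (k - K * A)) y \<in> Bs" using k by (simp add: Bs_def anc_add)
      show ?thesis
      proof (rule bexI)
        show "\<forall>e\<in>U ((par ^^ (k - K * A)) y). e \<in> ptree \<and> y \<notin> component (ptree - {e}) x"
          using U[OF b] by (metis (lifting))
      qed (use b in simp)
    next
      case False
      then have "\<forall>e\<in>U0. e \<in> ptree \<and> y \<notin> component (ptree - {e}) x" using U0(4) by simp
      then show ?thesis by (intro bexI[of _ U0]) simp_all
    qed
  qed
  then show ?thesis by blast
qed

end

section \<open>Percolation and measurability\<close>

lemma pred_component:
  fixes S :: "'a \<Rightarrow> nat set set"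
  assumes S: "\<And>e. Measurable.pred M (\<lambda>\<omega>. e \<in> S \<omega>)"
  shows "Measurable.pred M (\<lambda>\<omega>. y \<in> component (S \<omega>) x)"
proof -
  have "Measurable.pred M (\<lambda>\<omega>. (x, y) \<in> adj (S \<omega>) ^^ n)" for n y
  proof (induction n arbitrary: y)
    case (Suc n)
    have "(\<lambda>\<omega>. (x, y) \<in> adj (S \<omega>) ^^ Suc n) =
        (\<lambda>\<omega>. \<exists>z. (x, z) \<in> adj (S \<omega>) ^^ n \<and> {z, y} \<in> S \<omega>)"
      by (auto simp: adj_def)
    then show ?case using Suc S by simp
  qed simp
  then show ?thesis unfolding component_def rtrancl_power by simp
qed

lemma component_mono: "E \<subseteq> F \<Longrightarrow> component E x \<subseteq> component F x"
  unfolding component_def using rtrancl_mono[of "adj E" "adj F"] by (auto simp: adj_def)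

section \<open>Bernoulli percolation and cut families\<close>

lemma product_prob_space_bernoulli:
  "product_prob_space (\<lambda>_ :: 'a. measure_pmf (bernoulli_pmf p))"
  by unfold_locales

lemma prob_space_percolation: "prob_space (percolation T p)"
  unfolding percolation_def by (intro prob_space_PiM prob_space_measure_pmf)

lemma sets_all_open: "U \<subseteq> T \<Longrightarrow> finite U \<Longrightarrow>
    {\<xi> \<in> space (percolation T p). \<forall>e\<in>U. \<xi> e} \<in> sets (percolation T p)"
  unfolding percolation_def by measurable blast

lemma prob_all_open:
  assumes "U \<subseteq> T" "finite U" "0 \<le> p" "p \<le> 1"
  shows "measure (percolation T p) {\<xi> \<in> space (percolation T p). \<forall>e\<in>U. \<xi> e} = p ^ card U"
proof -
  interpret product_prob_space "\<lambda>_. measure_pmf (bernoulli_pmf p)" T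
    by (rule product_prob_space_bernoulli)
  have "emeasure (percolation T p) {\<xi> \<in> space (percolation T p). \<forall>e\<in>U. \<xi> e \<in> {True}} =
      (\<Prod>e\<in>U. emeasure (measure_pmf (bernoulli_pmf p)) {True})"
    unfolding percolation_def using assms by (intro emeasure_PiM_Collect) auto
  also have "\<dots> = ennreal (p ^ card U)"
    using assms by (simp add: emeasure_pmf_single ennreal_power)
  finally show ?thesis
    using assms by (simp add: measure_def)
qed

text \<open>An infinite cluster leaves the finite set \<open>D\<close>, and an open connection to a
  vertex outside \<open>D\<close> uses every edge of some cut set. The union bound finishes, since
  powers increase from \<open>p\<close> to \<open>q\<close>.\<close>

lemma percolation_prob_le:
  assumes cut: "cut_family E T x q \<epsilon> D \<U>" and p: "0 \<le> p" "p \<le> q" "q \<le> 1"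
  shows "percolation_prob T x p \<le> \<epsilon>"
proof -
  interpret prob_space "percolation T p" by (rule prob_space_percolation)
  \<comment> \<open>Only sets of edges of \<open>T\<close> give events in the percolation space over
    \<open>T\<close>; those provided by the cut condition are of this kind.\<close>
  define \<V> where "\<V> = {U \<in> \<U>. U \<subseteq> T}"
  define B where "B U = {\<xi> \<in> space (percolation T p). \<forall>e\<in>U. \<xi> e}" for U
  have \<V>: "finite \<V>" "\<And>U. U \<in> \<V> \<Longrightarrow> finite U \<and> U \<subseteq> T"
    using cut by (auto simp: cut_family_def \<V>_def)
  have B: "B U \<in> events" "prob (B U) = p ^ card U" if "U \<in> \<V>" for U
    using sets_all_open[of U T p] prob_all_open[of U T p] \<V>(2)[OF that] p unfolding B_def by auto
  have "{\<xi> \<in> space (percolation T p). infinite (component {e \<in> T. \<xi> e} x)} \<subseteq> (\<Union>U\<in>\<V>. B U)"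
  proof
    fix \<xi> assume "\<xi> \<in> {\<xi> \<in> space (percolation T p). infinite (component {e \<in> T. \<xi> e} x)}"
    then have \<xi>: "\<xi> \<in> space (percolation T p)" "infinite (component {e \<in> T. \<xi> e} x)" by auto
    then obtain y where y: "y \<in> component {e \<in> T. \<xi> e} x" "y \<notin> D"
      using cut unfolding cut_family_def by (meson finite_subset subsetI)
    then obtain U where U: "U \<in> \<U>" "\<And>e. e \<in> U \<Longrightarrow> e \<in> T \<and> y \<notin> component (T - {e}) x"
      using cut unfolding cut_family_def by metis
    have "\<xi> e" if "e \<in> U" for e
    proof (rule ccontr)
      assume "\<not> \<xi> e"
      then have "{e \<in> T. \<xi> e} \<subseteq> T - {e}" by auto
      from component_mono[OF this, of x] show False using y(1) U(2)[OF that] by blast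
    qed
    then have "\<xi> \<in> B U" using \<xi> by (simp add: B_def)
    moreover have "U \<in> \<V>" using U by (auto simp: \<V>_def)
    ultimately show "\<xi> \<in> (\<Union>U\<in>\<V>. B U)" by blast
  qed
  then have "percolation_prob T x p \<le> prob (\<Union>U\<in>\<V>. B U)"
    unfolding percolation_prob_def using B \<V> by (intro finite_measure_mono) auto
  also have "\<dots> \<le> (\<Sum>U\<in>\<V>. prob (B U))"
    using B \<V> by (intro finite_measure_subadditive_finite) auto
  also have "\<dots> = (\<Sum>U\<in>\<V>. p ^ card U)" using B by simp
  also have "\<dots> \<le> (\<Sum>U\<in>\<V>. q ^ card U)" using p by (intro sum_mono power_mono) auto
  also have "\<dots> \<le> (\<Sum>U\<in>\<U>. q ^ card U)"
    using cut p by (intro sum_mono2) (auto simp: cut_family_def \<V>_def)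
  also have "\<dots> \<le> \<epsilon>" using cut by (simp add: cut_family_def)
  finally show ?thesis .
qed

text \<open>Puts 1 into the set whose infimum is \<open>p_c\<close>, so that the infimum is not
  taken over the empty set.\<close>

lemma percolation_prob_1:
  fixes T :: "nat set set"
  assumes "countable T" "infinite (component T x)"
  shows "percolation_prob T x 1 = 1"
proof -
  interpret prob_space "percolation T 1" by (rule prob_space_percolation)
  have "b" if "b \<in> set_pmf (bernoulli_pmf 1)" for b
    using that by (cases b) (auto simp: set_pmf_iff)
  then have "AE \<xi> in percolation T 1. \<xi> e" if "e \<in> T" for e
    unfolding percolation_def using that
    by (intro AE_PiM_component[where P = "\<lambda>b. b"] prob_space_measure_pmf)
      (auto simp: AE_measure_pmf_iff)
  then have "AE \<xi> in percolation T 1. \<forall>e\<in>T. \<xi> e"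
    using assms(1) by (simp add: AE_ball_countable)
  then have AE: "AE \<xi> in percolation T 1. infinite (component {e \<in> T. \<xi> e} x)"
  proof eventually_elim
    case (elim \<xi>)
    then have "{e \<in> T. \<xi> e} = T" by auto
    then show ?case using assms(2) by simp
  qed
  have "Measurable.pred (percolation T 1) (\<lambda>\<xi>. e \<in> {e \<in> T. \<xi> e})" for e
    unfolding percolation_def by (cases "e \<in> T") simp_all
  then have "Measurable.pred (percolation T 1) (\<lambda>\<xi>. y \<in> component {e \<in> T. \<xi> e} x)" for y
    by (rule pred_component)
  then have "Measurable.pred (percolation T 1) (\<lambda>\<xi>. infinite (component {e \<in> T. \<xi> e} x))"
    unfolding infinite_nat_iff_unbounded_le by simp
  then show ?thesis
    unfolding percolation_prob_def using AE prob_Collect_eq_1 by (simp add: pred_def)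
qed

text \<open>
  Unlike \<open>p_c T x = 1\<close> itself, this sufficient condition is visibly measurable in \<open>T\<close>: it involves only
  countable quantifiers.
\<close>

definition has_cut_families :: "nat set set \<Rightarrow> nat set set \<Rightarrow> nat \<Rightarrow> bool" where
  "has_cut_families E T x \<longleftrightarrow>
     (\<forall>m n. \<exists>D \<U>. cut_family E T x (1 - 1 / real (m + 2)) (1 / real (n + 1)) D \<U>)"

lemma p_c_eq_1:
  assumes "countable T" "infinite (component T x)" "has_cut_families E T x"
  shows "p_c T x = 1"
proof -
  have "percolation_prob T x p = 0" if p: "0 \<le> p" "p < 1" for p
  proof -
    obtain m where "1 / real (m + 1) < 1 - p"
      using reals_Archimedean[of "1 - p"] p by (auto simp: field_simps)
    moreover have "1 / real (m + 2) \<le> 1 / real (m + 1)" by (intro divide_left_mono) auto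
    ultimately have m: "p \<le> 1 - 1 / real (m + 2)" by linarith
    have le: "percolation_prob T x p \<le> 1 / real (n + 1)" for n
    proof -
      obtain D \<U> where "cut_family E T x (1 - 1 / real (m + 2)) (1 / real (n + 1)) D \<U>"
        using assms(3) unfolding has_cut_families_def by blast
      then show ?thesis by (rule percolation_prob_le) (use p m in auto)
    qed
    have "percolation_prob T x p \<le> 0"
    proof (rule ccontr)
      assume "\<not> ?thesis"
      then obtain n where "1 / real (n + 1) < percolation_prob T x p"
        using reals_Archimedean[of "percolation_prob T x p"] by (auto simp: field_simps)
      then show False using le[of n] by simp
    qed
    then show ?thesis using measure_nonneg by (simp add: percolation_prob_def order_antisym)
  qed
  then have "{p \<in> {0..1}. percolation_prob T x p > 0} = {1}"
    using percolation_prob_1[OF assms(1,2)] by (force simp: le_less)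
  then show ?thesis by (simp add: p_c_def)
qed

section \<open>Measurable events for random edge sets\<close>

lemma space_edge_subsets [simp]: "space (edge_subsets E) = Pow E"
  by (simp add: edge_subsets_def space_measure_of_conv)

lemma pred_edge: "Measurable.pred (edge_subsets E) (\<lambda>T. e \<in> T)"
proof (cases "e \<in> E")
  case True
  have "{F \<in> Pow E. e \<in> F} \<in> sets (edge_subsets E)"
    unfolding edge_subsets_def using True by (intro in_measure_of) auto
  then show ?thesis by (simp add: pred_def)
next
  case False
  then have "{F \<in> Pow E. e \<in> F} = {}" by auto
  then show ?thesis by (simp only: pred_def space_edge_subsets sets.empty_sets)
qed

lemma measurable_edge_subsetsI:
  assumes "\<And>\<omega>. \<omega> \<in> space M \<Longrightarrow> F \<omega> \<subseteq> E" "\<And>e. e \<in> E \<Longrightarrow> Measurable.pred M (\<lambda>\<omega>. e \<in> F \<omega>)"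
  shows "F \<in> measurable M (edge_subsets E)"
  unfolding edge_subsets_def
proof (rule measurable_measure_of)
  show "F \<in> space M \<rightarrow> Pow E" using assms by auto
  fix A assume "A \<in> {{F \<in> Pow E. e \<in> F} | e. e \<in> E}"
  then obtain e where "e \<in> E" "A = {F \<in> Pow E. e \<in> F}" by blast
  moreover from this have "F -` A \<inter> space M = {\<omega> \<in> space M. e \<in> F \<omega>}" using assms(1) by auto
  ultimately show "F -` A \<inter> space M \<in> sets M" using assms(2)[of e] by (simp add: pred_def)
qed auto

lemma pred_spanning_tree:
  fixes E :: "nat set set"
  assumes "graph UNIV E"
  shows "Measurable.pred (edge_subsets E) (\<lambda>T. spanning_tree UNIV E T)"
proof -
  have eq: "spanning_tree UNIV E T \<longleftrightarrow> (\<forall>x y. y \<in> component T x) \<and> (\<nexists>xs. cycle T xs)"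
    if "T \<in> space (edge_subsets E)" for T
    using that assms by (auto simp: spanning_tree_def tree_def connected_graph_def graph_def)
  have "Measurable.pred (edge_subsets E) (\<lambda>T. cycle T xs)" for xs :: "nat list"
  proof -
    note pred_edge [measurable]
    have eq: "cycle T xs \<longleftrightarrow> 3 \<le> length xs \<and> distinct xs \<and>
        (\<forall>i\<in>{..<length xs}. {xs ! i, xs ! (Suc i mod length xs)} \<in> T)" for T :: "nat set set"
      by (auto simp: cycle_def adj_def)
    show ?thesis unfolding eq by measurable
  qed
  moreover have "Measurable.pred (edge_subsets E) (\<lambda>T. y \<in> component T x)" for x y
    by (rule pred_component) (rule pred_edge)
  ultimately have "Measurable.pred (edge_subsets E) (\<lambda>T. (\<forall>x y. y \<in> component T x) \<and> (\<nexists>xs. cycle T xs))"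
    by simp
  then show ?thesis by (rule measurable_cong[THEN iffD1, rotated]) (rule eq[symmetric])
qed

lemma pred_has_cut_families:
  assumes "countable E"
  shows "Measurable.pred (edge_subsets E) (\<lambda>T. has_cut_families E T x)"
proof -
  let ?M = "edge_subsets E"
  let ?\<D> = "{D :: nat set. finite D}" and ?\<F> = "{\<U>. finite \<U> \<and> \<U> \<subseteq> {U. finite U \<and> U \<subseteq> E}}"
  have cf: "cut_family E T x q \<epsilon> D \<U> \<longleftrightarrow> D \<in> ?\<D> \<and> \<U> \<in> ?\<F> \<and> (\<Sum>U\<in>\<U>. q ^ card U) \<le> \<epsilon> \<and>
      (\<forall>y. y \<notin> D \<longrightarrow> (\<exists>U\<in>\<U>. \<forall>e\<in>U. e \<in> T \<and> y \<notin> component (T - {e}) x))" for T q \<epsilon> D \<U>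
    by (auto simp: cut_family_def)
  have ex: "(\<exists>D \<U>. cut_family E T x q \<epsilon> D \<U>) \<longleftrightarrow> (\<exists>z\<in>?\<D> \<times> ?\<F>. cut_family E T x q \<epsilon> (fst z) (snd z))"
    for T q \<epsilon>
    unfolding cf by force
  have comp: "Measurable.pred ?M (\<lambda>T. y \<in> component (T - {e}) x)" for y e
  proof (rule pred_component)
    fix f show "Measurable.pred ?M (\<lambda>T. f \<in> T - {e})"
      by (cases "f = e") (simp_all add: pred_edge)
  qed
  have count: "countable (?\<D> \<times> ?\<F>)"
    by (intro countable_SIGMA countable_Collect_finite countable_Collect_finite_subset assms)
  have "Measurable.pred ?M (\<lambda>T. cut_family E T x q \<epsilon> D \<U>)" if "\<U> \<in> ?\<F>" for q \<epsilon> D \<U>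
  proof -
    have fin: "finite \<U>" "\<And>U. U \<in> \<U> \<Longrightarrow> finite U" using that by auto
    have "Measurable.pred ?M (\<lambda>T. \<exists>U\<in>\<U>. \<forall>e\<in>U. e \<in> T \<and> y \<notin> component (T - {e}) x)" for y
      using pred_edge comp fin by (intro pred_intros_finite pred_intros_logic) auto
    then show ?thesis unfolding cf by simp
  qed
  then have "Measurable.pred ?M (\<lambda>T. \<exists>D \<U>. cut_family E T x q \<epsilon> D \<U>)" for q \<epsilon>
    unfolding ex pred_def using count
    by (intro sets.sets_Collect_countable_Ex') (auto simp: pred_def)
  then show ?thesis unfolding has_cut_families_def by simp
qed

text \<open>Serves for the action of an automorphism on configurations. Injectivity of
  \<open>\<psi>\<close> keeps the new coordinates independent, and \<open>D\<close> matches their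
  laws one by one.\<close>

lemma distr_PiM_relabel:
  fixes D :: "'i \<Rightarrow> 'a pmf"
  assumes "inj \<psi>" and D: "\<And>j. map_pmf (h j) (D (\<psi> j)) = D j"
  defines "P \<equiv> PiM UNIV (\<lambda>i. measure_pmf (D i))"
  shows "distr P P (\<lambda>\<xi> j. h j (\<xi> (\<psi> j))) = P"
proof -
  let ?M = "\<lambda>i. measure_pmf (D i)" and ?\<Phi> = "\<lambda>\<xi> j. h j (\<xi> (\<psi> j))"
  interpret product_prob_space ?M UNIV by unfold_locales
  have space: "space P = UNIV" by (simp add: P_def space_PiM)
  have meas: "?\<Phi> \<in> measurable P P"
    unfolding P_def
  proof (rule measurable_PiM_single')
    fix j :: 'i
    have "(\<lambda>\<xi>. \<xi> (\<psi> j)) \<in> measurable (PiM UNIV ?M) (?M (\<psi> j))" by simp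
    then show "(\<lambda>\<xi>. h j (\<xi> (\<psi> j))) \<in> measurable (PiM UNIV ?M) (?M j)"
      by (rule measurable_compose) simp
  qed (auto simp: space_PiM)
  show ?thesis
    unfolding P_def
  proof (rule PiM_eq)
    fix J A assume J: "finite J" and A: "\<And>j. j \<in> J \<Longrightarrow> A j \<in> sets (?M j)"
    define X where "X k = h (inv \<psi> k) -` A (inv \<psi> k)" for k
    have X: "X (\<psi> j) = h j -` A j" for j using \<open>inj \<psi>\<close> by (simp add: X_def)
    let ?B = "prod_emb UNIV ?M J (Pi\<^sub>E J A)"
    have B: "?B \<in> sets P" unfolding P_def using J by (intro sets_PiM_I) auto
    have "?\<Phi> -` ?B \<inter> space P = {\<xi> \<in> space P. \<forall>k\<in>\<psi> ` J. \<xi> k \<in> X k}"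
      unfolding prod_emb_def by (auto simp: X space PiE_iff restrict_def extensional_def)
    then have "emeasure (distr P P ?\<Phi>) ?B = (\<Prod>k\<in>\<psi> ` J. emeasure (?M k) (X k))"
      unfolding emeasure_distr[OF meas B] using J emeasure_PiM_Collect[of "\<psi> ` J" X]
      by (simp add: P_def)
    also have "\<dots> = (\<Prod>j\<in>J. emeasure (?M (\<psi> j)) (h j -` A j))"
      using \<open>inj \<psi>\<close> by (subst prod.reindex) (auto simp: X intro: inj_on_subset)
    also have "\<dots> = (\<Prod>j\<in>J. emeasure (?M j) (A j))"
      by (intro prod.cong refl) (metis D emeasure_map_pmf)
    finally show "emeasure (distr (PiM UNIV ?M) (PiM UNIV ?M) ?\<Phi>) ?B = (\<Prod>j\<in>J. emeasure (?M j) (A j))"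
      by (simp add: P_def)
  qed simp
qed

text \<open>The intersection of the \<open>B n\<close> over \<open>n \<ge> m\<close> is contained in
  each of them, so its probability is below every member of a null sequence.\<close>

lemma (in prob_space) AE_not_in_vanishing:
  assumes "\<And>n. B n \<in> events" "(\<lambda>n. prob (B n)) \<longlonglongrightarrow> 0"
  shows "AE \<omega> in M. \<exists>n\<ge>m. \<omega> \<notin> B n"
proof -
  define N where "N = (\<Inter>n. B (m + n))"
  have N: "N \<in> events" using assms(1) unfolding N_def by auto
  have "prob N \<le> prob (B n)" if "n \<ge> m" for n
  proof (rule finite_measure_mono)
    show "N \<subseteq> B n" unfolding N_def using that by (metis INT_lower UNIV_I le_Suc_ex)
  qed (rule assms)
  then have "prob N \<le> 0"
    by (intro LIMSEQ_le_const[OF assms(2)]) auto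
  then have "N \<in> null_sets M"
    using N measure_nonneg[of M N] by (auto simp: null_sets_def emeasure_eq_measure)
  from AE_not_in[OF this] show ?thesis
    by eventually_elim (auto simp: N_def intro: exI[of _ "m + _"])
qed

section \<open>The random configuration\<close>

lemma geometric_tail: "measure (measure_pmf (geometric_pmf (1/2))) {n..} = (1/2) ^ n"
proof (induction n)
  case (Suc n)
  have eq: "{n..} = {n} \<union> {Suc n..}" by auto
  have "measure (geometric_pmf (1/2)) {n..} =
      measure (geometric_pmf (1/2)) {n} + measure (geometric_pmf (1/2)) {Suc n..}"
    unfolding eq by (rule measure_pmf.finite_measure_Union) auto
  then show ?case using Suc by (simp add: measure_pmf_single)
qed simp

text \<open>
  The tails drop so fast that among the first \<open>r * 2 ^ r\<^sup>2\<close> labels one is at least \<open>r\<close>, while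
  none exceeds \<open>r\<close> for a much longer time.
\<close>

definition label_pmf :: "nat pmf" where
  "label_pmf = map_pmf floor_sqrt (geometric_pmf (1/2))"

lemma label_tail: "measure (measure_pmf label_pmf) {r..} = (1/2) ^ r\<^sup>2"
proof -
  have "floor_sqrt -` {r..} = {r\<^sup>2..}" by (auto simp: le_floor_sqrt_iff)
  then show ?thesis by (simp add: label_pmf_def geometric_tail)
qed

context horo_tree
begin

text \<open>Coordinate \<open>Inl y\<close> is the favourite child of \<open>y\<close>, and \<open>Inr i\<close> is the label of level \<open>i\<close>.\<close>

definition coord_pmf :: "nat + int \<Rightarrow> nat pmf" where
  "coord_pmf i = (case i of Inl y \<Rightarrow> pmf_of_set {u. par u = y} | Inr _ \<Rightarrow> label_pmf)"

definition config :: "(nat + int \<Rightarrow> nat) measure" where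
  "config = PiM UNIV (\<lambda>i. measure_pmf (coord_pmf i))"

definition fav :: "(nat + int \<Rightarrow> nat) \<Rightarrow> nat \<Rightarrow> nat" where "fav \<xi> y = \<xi> (Inl y)"

definition label :: "(nat + int \<Rightarrow> nat) \<Rightarrow> int \<Rightarrow> nat" where "label \<xi> i = \<xi> (Inr i)"

abbreviation random_tree :: "(nat + int \<Rightarrow> nat) \<Rightarrow> nat set set" where
  "random_tree \<xi> \<equiv> env.ptree par lev (fav \<xi>) (label \<xi>)"

lemma children_nonempty: "{u. par u = y} \<noteq> {}"
  using two_children by blast

lemma product_prob_space_coord: "product_prob_space (\<lambda>i. measure_pmf (coord_pmf i))"
  by unfold_locales

lemma prob_space_config: "prob_space config"
  unfolding config_def by (intro prob_space_PiM prob_space_measure_pmf)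

lemma space_config [simp]: "space config = UNIV"
  by (simp add: config_def space_PiM)

section \<open>Measurability and invariance of the random tree\<close>

lemma measurable_coord [measurable]: "(\<lambda>\<xi>. \<xi> i) \<in> measurable config (count_space UNIV)"
proof -
  have "(\<lambda>\<xi>. \<xi> i) \<in> measurable config (measure_pmf (coord_pmf i))"
    unfolding config_def by simp
  then show ?thesis by simp
qed

lemma measurable_fav [measurable]: "(\<lambda>\<xi>. fav \<xi> y) \<in> measurable config (count_space UNIV)"
  and measurable_label [measurable]: "(\<lambda>\<xi>. label \<xi> i) \<in> measurable config (count_space UNIV)"
  unfolding fav_def label_def by measurable

lemma env: "env par lev" by unfold_locales

lemma measurable_dom [measurable]:
  "Measurable.pred config (\<lambda>\<xi>. env.dom par lev (fav \<xi>) (label \<xi>) x d)"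
  unfolding env.dom_def[OF env] by measurable

lemma measurable_idx [measurable]:
  "(\<lambda>\<xi>. env.idx par lev (fav \<xi>) (label \<xi>) x) \<in> measurable config (count_space UNIV)"
  unfolding env.idx_def[OF env] by measurable

lemma measurable_ext [measurable]:
  "(\<lambda>\<xi>. env.ext par lev (fav \<xi>) (label \<xi>) x) \<in> measurable config (count_space UNIV)"
  unfolding env.ext_def[OF env] by measurable

lemma measurable_label_idx [measurable]:
  "(\<lambda>\<xi>. label \<xi> (lev x - int (env.idx par lev (fav \<xi>) (label \<xi>) x))) \<in> measurable config (count_space UNIV)"
  by (rule measurable_compose_countable[where f = "\<lambda>n \<xi>. label \<xi> (lev x - int n)"]) measurable

lemma measurable_fav_fav [measurable]:
  "(\<lambda>\<xi>. fav \<xi> (fav \<xi> x)) \<in> measurable config (count_space UNIV)"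
  by (rule measurable_compose_countable[where f = "\<lambda>n \<xi>. fav \<xi> n"]) measurable

lemma measurable_nxt [measurable]:
  "(\<lambda>\<xi>. env.nxt par lev (fav \<xi>) (label \<xi>) x) \<in> measurable config (count_space UNIV)"
  unfolding env.nxt_def[OF env] Let_def by measurable

lemma measurable_random_tree: "random_tree \<in> measurable config (edge_subsets edges)"
proof (rule measurable_edge_subsetsI)
  show "random_tree \<xi> \<subseteq> edges" for \<xi> by (simp add: env.ptree_def[OF env])
  fix e
  have "(\<lambda>\<xi>. e \<in> random_tree \<xi>) =
      (\<lambda>\<xi>. e \<in> edges \<and> (\<exists>u v. env.nxt par lev (fav \<xi>) (label \<xi>) u = v \<and> e = {u, v}))"
    by (auto simp: env.ptree_def[OF env])
  also have "Measurable.pred config \<dots>" by measurable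
  finally show "Measurable.pred config (\<lambda>\<xi>. e \<in> random_tree \<xi>)" .
qed

text \<open>Every ingredient of the tree is defined from parents, levels, favourites and labels
  alone, so it moves along with \<open>g\<close> once labels are shifted by the level shift
  \<open>s\<close>.\<close>

lemma ptree_equivariant:
  assumes g: "g \<in> Aut UNIV edges" "\<And>x. lev (g x) = lev x + s"
    and c: "\<And>x. c' (g x) = g (c x)" and lab: "\<And>i. lab' (i + s) = lab i"
  shows "env.ptree par lev c' lab' = (\<lambda>e. g ` e) ` env.ptree par lev c lab"
proof -
  interpret A: env par lev c lab by unfold_locales
  interpret B: env par lev c' lab' by unfold_locales
  have bij: "bij g" and par: "\<And>x. par (g x) = g (par x)" using g(1) by (auto simp: Aut_iff)
  have inj: "g x = g y \<longleftrightarrow> x = y" for x y using bij by (meson bij_is_inj inj_eq)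
  have anc: "(par ^^ n) (g x) = g ((par ^^ n) x)" for n x
    by (induction n) (simp_all add: par)
  have lab': "lab' (lev (g x) - i) = lab (lev x - i)" "lab' (lev (g x) + i) = lab (lev x + i)" for x i
    using lab[of "lev x - i"] lab[of "lev x + i"] by (simp_all add: g(2) algebra_simps)
  have dom: "B.dom (g x) d = A.dom x d" for x d
    unfolding A.dom_def B.dom_def anc lab' c inj ..
  have idx: "B.idx (g x) = A.idx x" for x
    unfolding A.idx_def B.idx_def dom ..
  have ext: "B.ext (g x) = g (A.ext x)" for x
    by (simp add: A.ext_def B.ext_def par idx)
  have nxt: "B.nxt (g x) = g (A.nxt x)" for x
    by (simp add: A.nxt_def B.nxt_def par idx ext lab' c Let_def)
  have edge: "{g x, g y} \<in> edges \<longleftrightarrow> {x, y} \<in> edges" for x y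
    using g(1) by (simp add: Aut_def)
  show ?thesis
  proof (intro set_eqI iffI)
    fix e assume "e \<in> B.ptree"
    then obtain v where v: "e = {v, B.nxt v}" "e \<in> edges" by (auto simp: B.ptree_def)
    obtain u where u: "v = g u" using bij by (meson bij_pointE)
    have "e = g ` {u, A.nxt u}" using v u nxt by simp
    moreover have "{u, A.nxt u} \<in> A.ptree" using v u nxt edge by (auto simp: A.ptree_def)
    ultimately show "e \<in> (\<lambda>e. g ` e) ` A.ptree" by blast
  next
    fix e assume "e \<in> (\<lambda>e. g ` e) ` A.ptree"
    then obtain u where u: "e = {g u, g (A.nxt u)}" "{u, A.nxt u} \<in> edges" by (auto simp: A.ptree_def)
    have "e = {g u, B.nxt (g u)}" using u nxt by simp
    moreover have "e \<in> edges" using u edge by simp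
    ultimately show "e \<in> B.ptree" unfolding B.ptree_def by blast
  qed
qed

definition tree_law :: "nat set set measure" where
  "tree_law = distr config (edge_subsets edges) random_tree"

text \<open>Moving the tree by \<open>g\<close> amounts to moving the configuration by
  \<open>\<Phi>\<close>. This preserves the product measure because \<open>g\<close> maps children
  bijectively to children and all labels have the same law.\<close>

lemma invariant_tree_law: "Aut_invariant UNIV edges tree_law"
  unfolding Aut_invariant_def
proof
  fix g assume g: "g \<in> Aut UNIV edges"
  obtain s where s: "\<And>x. lev (g x) = lev x + s" using Aut_lev[OF g] by blast
  have bij: "bij g" and par: "\<And>x. g (par x) = par (g x)" using g by (auto simp: Aut_iff)
  have inj: "g x = g y \<longleftrightarrow> x = y" for x y using bij by (meson bij_is_inj inj_eq)
  have ginv: "g (inv g x) = x" "inv g (g x) = x" for x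
    using bij by (simp_all add: bij_is_surj bij_is_inj surj_f_inv_f)
  have parinv: "par (inv g x) = inv g (par x)" for x
  proof -
    have "inv g (g (par (inv g x))) = inv g (par x)" by (simp only: par ginv)
    then show ?thesis by (simp only: ginv)
  qed
  \<comment> \<open>In the moved configuration the favourite of \<open>y\<close> is the
    \<open>g\<close>-image of the old favourite of \<open>inv g y\<close>, and level
    \<open>i\<close> takes the label of level \<open>i - s\<close>.\<close>
  define \<psi> where "\<psi> = map_sum (inv g) (\<lambda>i. i - s)"
  define h where "h j = (case j of Inl (y :: nat) \<Rightarrow> g | Inr (i :: int) \<Rightarrow> id)" for j
  define \<Phi> where "\<Phi> = (\<lambda>\<xi> j. h j (\<xi> (\<psi> j)))"
  have "inj \<psi>"
  proof (rule injI)
    fix i j assume "\<psi> i = \<psi> j"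
    then show "i = j" using ginv by (cases i; cases j) (auto simp: \<psi>_def dest: arg_cong[of _ _ g])
  qed
  moreover have "map_pmf (h j) (coord_pmf (\<psi> j)) = coord_pmf j" for j
  proof (cases j)
    case (Inl y)
    have "g ` {u. par u = inv g y} = {u. par u = y}"
    proof (intro equalityI subsetI)
      fix u assume "u \<in> {u. par u = y}"
      then have "inv g u \<in> {u. par u = inv g y}" by (simp add: parinv)
      from imageI[OF this, of g] show "u \<in> g ` {u. par u = inv g y}" by (simp add: ginv)
    qed (auto simp: par[symmetric] ginv)
    moreover have "inj_on g {u. par u = inv g y}"
      using bij by (meson bij_is_inj inj_on_subset subset_UNIV)
    ultimately show ?thesis
      using Inl children_nonempty finite_children
      by (simp add: h_def \<psi>_def coord_pmf_def map_pmf_of_set_inj)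
  qed (simp add: h_def \<psi>_def coord_pmf_def)
  ultimately have \<Phi>: "distr config config \<Phi> = config"
    unfolding config_def \<Phi>_def by (rule distr_PiM_relabel)
  have \<Phi>_meas: "\<Phi> \<in> measurable config config"
  proof -
    have "(\<lambda>\<xi>. h j (\<xi> (\<psi> j))) \<in> measurable config (measure_pmf (coord_pmf j))" for j
      using measurable_compose[OF measurable_coord[of "\<psi> j"], of "h j" "count_space UNIV"] by simp
    then have "\<Phi> \<in> measurable config (PiM UNIV (\<lambda>i. measure_pmf (coord_pmf i)))"
      unfolding \<Phi>_def by (intro measurable_PiM_single') (auto simp: space_PiM)
    then show ?thesis by (simp add: config_def)
  qed
  have eq: "random_tree (\<Phi> \<xi>) = (\<lambda>e. g ` e) ` random_tree \<xi>" for \<xi>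
    by (rule ptree_equivariant[OF g s])
      (simp_all add: fav_def label_def \<Phi>_def h_def \<psi>_def ginv)
  have edge: "{g x, g y} \<in> edges \<longleftrightarrow> {x, y} \<in> edges" for x y
    using g by (simp add: Aut_def)
  have gE: "g ` e \<in> edges \<longleftrightarrow> e \<in> edges" for e
  proof -
    have "g ` e \<in> edges \<Longrightarrow> \<exists>x y. e = {x, y}"
    proof -
      assume "g ` e \<in> edges"
      then obtain a b where "g ` e = {a, b}" by (auto simp: edges_def)
      then have "inv g ` g ` e = {inv g a, inv g b}" by simp
      moreover have "inv g ` g ` e = e" using ginv by (simp add: image_image)
      ultimately show ?thesis by auto
    qed
    moreover have "e \<in> edges \<Longrightarrow> \<exists>x y. e = {x, y}" by (auto simp: edges_def)
    moreover have "g ` e \<in> edges \<longleftrightarrow> e \<in> edges" if "\<exists>x y. e = {x, y}"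
      using that edge by auto
    ultimately show ?thesis by blast
  qed
  have act: "(\<lambda>T. (\<lambda>e. g ` e) ` T) \<in> measurable (edge_subsets edges) (edge_subsets edges)"
  proof (rule measurable_edge_subsetsI)
    fix T assume "T \<in> space (edge_subsets edges)"
    then show "(\<lambda>e. g ` e) ` T \<subseteq> edges" using gE by auto
  next
    fix e
    have "e \<in> (\<lambda>e. g ` e) ` T \<longleftrightarrow> inv g ` e \<in> T" for T
    proof
      assume "inv g ` e \<in> T"
      moreover have "g ` inv g ` e = e" using ginv by (simp add: image_image)
      ultimately show "e \<in> (\<lambda>e. g ` e) ` T" by (metis imageI)
    qed (use ginv in \<open>auto simp: image_image\<close>)
    then show "Measurable.pred (edge_subsets edges) (\<lambda>T. e \<in> (\<lambda>e. g ` e) ` T)"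
      using pred_edge by simp
  qed
  have "distr tree_law tree_law (\<lambda>T. (\<lambda>e. g ` e) ` T) =
      distr tree_law (edge_subsets edges) (\<lambda>T. (\<lambda>e. g ` e) ` T)"
    by (rule distr_cong) (simp_all add: tree_law_def)
  also have "\<dots> = distr config (edge_subsets edges) ((\<lambda>T. (\<lambda>e. g ` e) ` T) \<circ> random_tree)"
    unfolding tree_law_def by (rule distr_distr[OF act measurable_random_tree])
  also have "(\<lambda>T. (\<lambda>e. g ` e) ` T) \<circ> random_tree = random_tree \<circ> \<Phi>"
    using eq by (auto simp: fun_eq_iff)
  also have "distr config (edge_subsets edges) (random_tree \<circ> \<Phi>) =
      distr (distr config config \<Phi>) (edge_subsets edges) random_tree"
    by (rule distr_distr[OF measurable_random_tree \<Phi>_meas, symmetric])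
  also have "\<dots> = tree_law" by (simp add: \<Phi> tree_law_def)
  finally show "distr tree_law tree_law (\<lambda>T. (\<lambda>e. g ` e) ` T) = tree_law" .
qed

section \<open>Almost sure properties of favourites and labels\<close>

lemma AE_par_fav: "AE \<xi> in config. \<forall>x. par (fav \<xi> x) = x"
  unfolding AE_all_countable
proof
  fix x
  have "AE u in measure_pmf (coord_pmf (Inl x)). par u = x"
    using children_nonempty finite_children by (simp add: AE_measure_pmf_iff coord_pmf_def)
  then show "AE \<xi> in config. par (fav \<xi> x) = x"
    unfolding config_def fav_def by (intro AE_PiM_component prob_space_measure_pmf) auto
qed

lemma prob_config:
  assumes "finite J"
  shows "measure config {\<xi>. \<forall>i\<in>J. \<xi> i \<in> X i} = (\<Prod>i\<in>J. measure (measure_pmf (coord_pmf i)) (X i))"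
proof -
  interpret product_prob_space "\<lambda>i. measure_pmf (coord_pmf i)" UNIV by (rule product_prob_space_coord)
  have "{\<xi>. \<forall>i\<in>J. \<xi> i \<in> X i} = prod_emb UNIV (\<lambda>i. measure_pmf (coord_pmf i)) J (Pi\<^sub>E J X)"
    by (auto simp: prod_emb_def space_PiM PiE_iff restrict_def extensional_def)
  then show ?thesis using measure_PiM_emb[of J X] assms by (simp add: config_def)
qed

text \<open>Along an ancestor line the favourites are chosen independently, and each stays on the
  line with probability one half.\<close>

lemma AE_unfavoured: "AE \<xi> in config. \<forall>m x. \<exists>n\<ge>m. fav \<xi> ((par ^^ Suc n) x) \<noteq> (par ^^ n) x"
proof -
  interpret prob_space config by (rule prob_space_config)
  have "AE \<xi> in config. \<exists>n\<ge>m. fav \<xi> ((par ^^ Suc n) x) \<noteq> (par ^^ n) x" for m x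
  proof -
    define B where "B k = {\<xi>. \<forall>n\<in>{m..<m + k}. fav \<xi> ((par ^^ Suc n) x) = (par ^^ n) x}" for k
    define f where "f n = (Inl ((par ^^ Suc n) x) :: nat + int)" for n
    \<comment> \<open>The exponent recovers \<open>n\<close> from the coordinate, as
      \<open>(par ^^ Suc n) x\<close> has level \<open>lev x - int n - 1\<close>. The empty set for
      labels is a dummy value.\<close>
    define X where "X i = (case i of Inl y \<Rightarrow> {(par ^^ nat (lev x - lev y - 1)) x} | Inr (_ :: int) \<Rightarrow> {})" for i
    have X: "X (f n) = {(par ^^ n) x}" for n by (simp add: X_def f_def)
    have "inj f"
    proof (rule injI)
      fix k n assume "f k = f n"
      then have "(par ^^ Suc k) x = (par ^^ Suc n) x" by (simp add: f_def)
      from arg_cong[OF this, of lev] show "k = n" by simp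
    qed
    have "prob (B k) = (1 / 2) ^ k" for k
    proof -
      have "\<xi> (f n) \<in> X (f n) \<longleftrightarrow> fav \<xi> ((par ^^ Suc n) x) = (par ^^ n) x" for \<xi> n
        unfolding X by (simp add: f_def fav_def)
      then have "B k = {\<xi>. \<forall>i\<in>f ` {m..<m + k}. \<xi> i \<in> X i}"
        unfolding B_def by simp
      then have "prob (B k) = (\<Prod>i\<in>f ` {m..<m + k}. measure (measure_pmf (coord_pmf i)) (X i))"
        using prob_config[of "f ` {m..<m + k}" X] by simp
      also have "\<dots> = (\<Prod>n\<in>{m..<m + k}. measure (measure_pmf (coord_pmf (f n))) (X (f n)))"
        using \<open>inj f\<close> by (subst prod.reindex) (auto intro: inj_on_subset)
      also have "\<dots> = (\<Prod>n\<in>{m..<m + k}. 1 / 2)"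
      proof (intro prod.cong refl)
        fix n
        show "measure (measure_pmf (coord_pmf (f n))) (X (f n)) = 1 / 2"
          unfolding X using children_nonempty finite_children card_children
          by (simp add: f_def coord_pmf_def measure_pmf_single)
      qed
      finally show ?thesis by simp
    qed
    moreover have "(\<lambda>k. (1 / 2 :: real) ^ k) \<longlonglongrightarrow> 0" by (rule LIMSEQ_realpow_zero) auto
    moreover have "B k \<in> events" for k
    proof -
      have "Measurable.pred config (\<lambda>\<xi>. \<forall>n\<in>{m..<m + k}. fav \<xi> ((par ^^ Suc n) x) = (par ^^ n) x)"
        by measurable
      then show ?thesis by (simp add: pred_def B_def)
    qed
    ultimately have "AE \<xi> in config. \<exists>k\<ge>0. \<xi> \<notin> B k"
      by (intro AE_not_in_vanishing) auto
    then show ?thesis by eventually_elim (auto simp: B_def)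
  qed
  then show ?thesis by (simp add: AE_all_countable)
qed

lemma prob_label_le:
  "measure config {\<xi>. label \<xi> j \<ge> r} = (1 / 2) ^ r\<^sup>2"
  using prob_config[of "{Inr j}" "\<lambda>_. {r..}"] by (simp add: label_def coord_pmf_def label_tail)

text \<open>Both failures at scale \<open>r\<close> have vanishing probability: no label reaches
  \<open>r\<close> on \<open>A r\<close> levels with probability at most
  \<open>exp (- real r)\<close>, and exceeding \<open>r\<close> within \<open>K * A r\<close> levels
  is unlikely because \<open>(Suc r)\<^sup>2 - r\<^sup>2 = 2 * r + 1\<close> beats the factor
  \<open>K * r\<close>.\<close>

lemma AE_labels:
  fixes l :: int and K :: nat
  defines "A \<equiv> \<lambda>r. r * 2 ^ r\<^sup>2"
  shows "AE \<xi> in config. \<exists>r\<ge>r0. (\<exists>i. l \<le> i \<and> i < l + int (A r) \<and> r \<le> label \<xi> i) \<and>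
     (\<forall>j. l \<le> j \<and> j \<le> l + int (K * A r) \<longrightarrow> label \<xi> j \<le> r)"
proof -
  interpret prob_space config by (rule prob_space_config)
  define B1 where "B1 r = {\<xi>. \<forall>i\<in>{l..<l + int (A r)}. label \<xi> i < r}" for r
  define B2 where "B2 r = (\<Union>j\<in>{l..l + int (K * A r)}. {\<xi>. label \<xi> j \<ge> Suc r})" for r
  have ev: "B1 r \<in> events" "{\<xi>. label \<xi> j \<ge> n} \<in> events" for r j n
  proof -
    have "Measurable.pred config (\<lambda>\<xi>. \<forall>i\<in>{l..<l + int (A r)}. label \<xi> i < r)"
      "Measurable.pred config (\<lambda>\<xi>. label \<xi> j \<ge> n)"
      by measurable
    then show "B1 r \<in> events" "{\<xi>. label \<xi> j \<ge> n} \<in> events"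
      by (simp_all add: pred_def B1_def)
  qed
  then have ev2: "B2 r \<in> events" for r unfolding B2_def by blast
  have 1: "prob (B1 r) \<le> exp (- real r)" for r
  proof -
    have "B1 r = {\<xi>. \<forall>i\<in>Inr ` {l..<l + int (A r)}. \<xi> i \<in> {..<r}}"
      by (auto simp: B1_def label_def)
    then have "prob (B1 r) = (\<Prod>i\<in>Inr ` {l..<l + int (A r)}. measure (measure_pmf (coord_pmf i)) {..<r})"
      using prob_config[of "Inr ` {l..<l + int (A r)}" "\<lambda>_. {..<r}"] by simp
    also have "\<dots> = (\<Prod>i\<in>{l..<l + int (A r)}. measure (measure_pmf label_pmf) {..<r})"
      by (subst prod.reindex) (auto simp: coord_pmf_def)
    also have "\<dots> = (1 - (1/2) ^ r\<^sup>2) ^ A r"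
    proof -
      have "{..<r} = UNIV - {r..}" by auto
      then have "measure (measure_pmf label_pmf) {..<r} = 1 - (1/2) ^ r\<^sup>2"
        using measure_pmf.prob_compl[of "{r..}" label_pmf] by (simp add: label_tail)
      then show ?thesis by simp
    qed
    also have "\<dots> \<le> exp (- ((1/2) ^ r\<^sup>2)) ^ A r"
      using exp_ge_add_one_self[of "- ((1/2) ^ r\<^sup>2)"] by (intro power_mono) (auto simp: power_le_one)
    also have "\<dots> = exp (- real r)"
      by (simp add: A_def power_one_over flip: exp_of_nat_mult)
    finally show ?thesis .
  qed
  have 2: "prob (B2 r) \<le> (real K * real r + 1) * (1/2) ^ r" for r
  proof -
    have "prob (B2 r) \<le> (\<Sum>j\<in>{l..l + int (K * A r)}. prob {\<xi>. label \<xi> j \<ge> Suc r})"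
      unfolding B2_def using ev by (intro finite_measure_subadditive_finite) auto
    also have "\<dots> = (real K * real r * 2 ^ r\<^sup>2 + 1) * (1/2) ^ (Suc r)\<^sup>2"
      by (simp add: prob_label_le A_def)
    also have "\<dots> \<le> ((real K * real r + 1) * 2 ^ r\<^sup>2) * (1/2) ^ (Suc r)\<^sup>2"
      by (intro mult_right_mono) (auto simp: algebra_simps)
    also have "\<dots> = (real K * real r + 1) * (1/2) ^ (2 * r + 1)"
      by (simp add: power2_eq_square power_add power_one_over mult_2_right field_simps)
    also have "\<dots> \<le> (real K * real r + 1) * (1/2) ^ r"
      by (intro mult_left_mono power_decreasing) auto
    finally show ?thesis .
  qed
  have "(\<lambda>r. prob (B1 r \<union> B2 r)) \<longlonglongrightarrow> 0"
  proof (rule tendsto_sandwich)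
    show "\<forall>\<^sub>F r in sequentially. 0 \<le> prob (B1 r \<union> B2 r)" by simp
    show "\<forall>\<^sub>F r in sequentially. prob (B1 r \<union> B2 r) \<le> exp (- real r) + (real K * real r + 1) * (1/2) ^ r"
    proof (rule always_eventually, rule allI)
      fix r
      have "prob (B1 r \<union> B2 r) \<le> prob (B1 r) + prob (B2 r)"
        using ev ev2 by (intro measure_Un_le) auto
      then show "prob (B1 r \<union> B2 r) \<le> exp (- real r) + (real K * real r + 1) * (1/2) ^ r"
        using 1[of r] 2[of r] by linarith
    qed
    have "(\<lambda>r. exp (- real r)) \<longlonglongrightarrow> 0" "(\<lambda>r. real r * (1/2) ^ r) \<longlonglongrightarrow> 0"
      "(\<lambda>r. (1/2 :: real) ^ r) \<longlonglongrightarrow> 0"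
      by real_asymp+
    then have "(\<lambda>r. exp (- real r) + (real K * (real r * (1/2) ^ r) + (1/2) ^ r)) \<longlonglongrightarrow> 0 + (real K * 0 + 0)"
      by (intro tendsto_add tendsto_mult tendsto_const)
    then show "(\<lambda>r. exp (- real r) + (real K * real r + 1) * (1/2) ^ r) \<longlonglongrightarrow> 0"
      by (simp add: algebra_simps)
  qed simp
  then have "AE \<xi> in config. \<exists>r\<ge>r0. \<xi> \<notin> B1 r \<union> B2 r"
    using ev ev2 by (intro AE_not_in_vanishing) auto
  then show ?thesis
  proof eventually_elim
    case (elim \<xi>)
    then obtain r where "r \<ge> r0" "\<xi> \<notin> B1 r" "\<xi> \<notin> B2 r" by auto
    then show ?case
      by (intro exI[of _ r]) (fastforce simp: B1_def B2_def not_less_eq_eq not_le not_less)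
  qed
qed

lemma AE_good_env: "AE \<xi> in config. good_env par lev (fav \<xi>) (label \<xi>)"
proof -
  have "AE \<xi> in config. \<forall>r0 l K. \<exists>r\<ge>r0. (\<exists>i. l \<le> i \<and> i < l + int (r * 2 ^ r\<^sup>2) \<and> r \<le> label \<xi> i) \<and>
     (\<forall>j. l \<le> j \<and> j \<le> l + int (K * (r * 2 ^ r\<^sup>2)) \<longrightarrow> label \<xi> j \<le> r)"
    using AE_labels by (simp only: AE_all_countable) blast
  with AE_par_fav AE_unfavoured show ?thesis
  proof eventually_elim
    case (elim \<xi>)
    show ?case
    proof
      show "par (fav \<xi> x) = x" for x using elim(1) by blast
      show "\<exists>n\<ge>m. fav \<xi> ((par ^^ Suc n) x) \<noteq> (par ^^ n) x" for m x using elim(2) by blast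
      fix m l :: int and K :: nat
      \<comment> \<open>Larger than all labels on the levels from \<open>l\<close> to
        \<open>m\<close>, so that a label of at least \<open>r0\<close> can only occur beyond
        \<open>m\<close>.\<close>
      define r0 where "r0 = Suc (Max (insert 0 (label \<xi> ` {l..m})))"
      obtain r where "r0 \<le> r" and i: "\<exists>i. l \<le> i \<and> i < l + int (r * 2 ^ r\<^sup>2) \<and> r \<le> label \<xi> i"
        and le: "\<And>j. l \<le> j \<Longrightarrow> j \<le> l + int (K * (r * 2 ^ r\<^sup>2)) \<Longrightarrow> label \<xi> j \<le> r"
        using elim(3) by meson
      from i obtain k where k: "k < r * 2 ^ r\<^sup>2" "r \<le> label \<xi> (l + int k)"
        by (metis add_less_cancel_left of_nat_less_iff zle_iff_zadd)
      \<comment> \<open>The first label of at least \<open>r\<close> is the required record: earlier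
        labels are below \<open>r\<close>, and later ones in the range are at most
        \<open>r\<close>.\<close>
      define n where "n = (LEAST n. r \<le> label \<xi> (l + int n))"
      have n: "r \<le> label \<xi> (l + int n)" "n < r * 2 ^ r\<^sup>2"
        using k LeastI[of "\<lambda>n. r \<le> label \<xi> (l + int n)" k] Least_le[of "\<lambda>n. r \<le> label \<xi> (l + int n)" k]
        unfolding n_def by simp_all
      have less: "label \<xi> j < r" if "l \<le> j" "j < l + int n" for j
      proof -
        have "nat (j - l) < n" using that by simp
        then have "\<not> r \<le> label \<xi> (l + int (nat (j - l)))"
          unfolding n_def by (rule not_less_Least)
        then show ?thesis using that by simp
      qed
      have "m \<le> l + int n"
      proof (rule ccontr)
        assume "\<not> m \<le> l + int n"
        then have "label \<xi> (l + int n) \<le> Max (insert 0 (label \<xi> ` {l..m}))"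
          by (intro Max_ge) auto
        then show False using n(1) \<open>r0 \<le> r\<close> by (simp add: r0_def)
      qed
      then show "\<exists>i A. m \<le> i \<and> l \<le> i \<and> i < l + int A \<and> (\<forall>j. l \<le> j \<and> j < i \<longrightarrow> label \<xi> j < label \<xi> i) \<and>
        (\<forall>j. i \<le> j \<and> j \<le> l + int (K * A) \<longrightarrow> label \<xi> j \<le> label \<xi> i)"
      proof (intro exI[of _ "l + int n"] exI[of _ "r * 2 ^ r\<^sup>2"] conjI allI impI)
        fix j assume "l \<le> j \<and> j < l + int n"
        then show "label \<xi> j < label \<xi> (l + int n)" using less[of j] n(1) by simp
      next
        fix j assume j: "l + int n \<le> j \<and> j \<le> l + int (K * (r * 2 ^ r\<^sup>2))"
        then have "l \<le> j" by simp
        then show "label \<xi> j \<le> label \<xi> (l + int n)" using le[of j] j n(1) by simp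
      next
        show "l + int n < l + int (r * 2 ^ r\<^sup>2)" using n(2) by (simp only: add_less_cancel_left of_nat_less_iff)
      qed simp_all
    qed
  qed
qed

section \<open>The law of the random tree\<close>

lemma countable_edges: "countable edges"
proof -
  have "edges \<subseteq> (\<lambda>(x, y). {x, y}) ` UNIV" by (auto simp: edges_def)
  then show ?thesis by (rule countable_subset) simp
qed

lemma AE_tree_law:
  "AE T in tree_law. spanning_tree UNIV edges T \<and> (\<forall>x. has_cut_families edges T x)"
proof -
  have meas: "{T \<in> space (edge_subsets edges). spanning_tree UNIV edges T \<and> (\<forall>x. has_cut_families edges T x)}
      \<in> sets (edge_subsets edges)"
  proof -
    have "Measurable.pred (edge_subsets edges)
        (\<lambda>T. spanning_tree UNIV edges T \<and> (\<forall>x. has_cut_families edges T x))"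
      using pred_spanning_tree[OF graph_edges] pred_has_cut_families[OF countable_edges] by simp
    then show ?thesis by (simp only: pred_def)
  qed
  show ?thesis
    unfolding tree_law_def AE_distr_iff[OF measurable_random_tree meas]
    using AE_good_env
  proof eventually_elim
    case (elim \<xi>)
    then interpret good_env par lev "fav \<xi>" "label \<xi>" .
    have "has_cut_families edges ptree x" for x
      unfolding has_cut_families_def using ex_cut_family by simp
    then show ?case using spanning_tree_ptree by blast
  qed
qed

lemma random_spanning_tree_law: "random_spanning_tree UNIV edges tree_law"
  unfolding random_spanning_tree_def
proof (intro conjI)
  show "prob_space tree_law"
    unfolding tree_law_def using measurable_random_tree prob_space_config
    by (intro prob_space.prob_space_distr) auto
  show "sets tree_law = sets (edge_subsets edges)" by (simp add: tree_law_def)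
  show "AE T in tree_law. spanning_tree UNIV edges T"
    using AE_tree_law by eventually_elim blast
qed

lemma AE_p_c: "AE T in tree_law. \<forall>x\<in>UNIV. p_c T x = 1"
  using AE_tree_law
proof eventually_elim
  case (elim T)
  have "p_c T x = 1" for x
  proof (rule p_c_eq_1)
    have "T \<subseteq> edges" using elim by (simp add: spanning_tree_def)
    then show "countable T" using countable_edges by (rule countable_subset)
    have "component T x = UNIV"
      using elim by (auto simp: spanning_tree_def tree_def connected_graph_def)
    then show "infinite (component T x)" by simp
    show "has_cut_families edges T x" using elim by blast
  qed
  then show ?case by blast
qed

lemma tree_law_properties:
  "transitive_graph UNIV edges \<and> \<not> unimodular UNIV edges \<and> infinite (ends UNIV edges) \<and>
   random_spanning_tree UNIV edges tree_law \<and> Aut_invariant UNIV edges tree_law \<and>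
   (AE \<omega> in tree_law. \<forall>x\<in>UNIV. p_c \<omega> x = 1)"
  using transitive_edges not_unimodular_edges infinite_ends random_spanning_tree_law
    invariant_tree_law AE_p_c by blast

end

section \<open>A concrete binary tree with a fixed end\<close>

text \<open>Tree vertices are pairs of a level and a position on that level, coded as natural
  numbers.\<close>

definition dec :: "nat \<Rightarrow> int \<times> nat" where "dec v = apfst int_decode (prod_decode v)"

definition enc :: "int \<times> nat \<Rightarrow> nat" where "enc z = prod_encode (apfst int_encode z)"

lemma dec_enc [simp]: "dec (enc z) = z" and enc_dec [simp]: "enc (dec v) = v"
  by (cases z) (simp_all add: dec_def enc_def apfst_def map_prod_def case_prod_unfold)

text \<open>The parent map deletes the last binary digit of the position. Every ancestor line
  finally runs through position 0 on all remaining levels, and this line represents the fixed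
  end.\<close>

definition half :: "int \<times> nat \<Rightarrow> int \<times> nat" where "half z = (fst z - 1, snd z div 2)"

lemma half_pow: "(half ^^ n) z = (fst z - int n, snd z div 2 ^ n)"
  by (induction n) (simp_all add: half_def div_mult2_eq[symmetric] mult.commute)

lemma half_common: "\<exists>m n. (half ^^ m) z = (half ^^ n) w"
proof -
  \<comment> \<open>Both exponents are large enough to delete all digits, and their
    \<open>nat\<close> terms bring the two vertices to the same level.\<close>
  define m where "m = nat (fst z - fst w) + snd z + snd w"
  define n where "n = nat (fst w - fst z) + snd z + snd w"
  have "snd z < 2 ^ m" "snd w < 2 ^ n"
    by (rule less_le_trans[OF less_exp], rule power_increasing, simp_all add: m_def n_def)+
  moreover have "fst z - int m = fst w - int n" by (simp add: m_def n_def)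
  ultimately show ?thesis by (metis half_pow div_less)
qed

lemma half_children: "{z. half z = w} = {(fst w + 1, 2 * snd w), (fst w + 1, 2 * snd w + 1)}"
proof (intro equalityI subsetI)
  fix z assume "z \<in> {z. half z = w}"
  then have "fst z = fst w + 1" "snd z = 2 * snd w \<or> snd z = 2 * snd w + 1"
    by (auto simp: half_def)
  then show "z \<in> {(fst w + 1, 2 * snd w), (fst w + 1, 2 * snd w + 1)}" by (cases z) auto
qed (auto simp: half_def)

text \<open>
  The automorphism flips the binary digits of \<open>snd\<close> according to the mask \<open>a\<close> at level \<open>n\<close>, and
  according to the shifted mask at the other levels.
\<close>

definition mask :: "int \<Rightarrow> nat \<Rightarrow> int \<Rightarrow> nat" where
  "mask n a p = (if p \<le> n then drop_bit (nat (n - p)) a else push_bit (nat (p - n)) a)"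

text \<open>This compatibility of the masks on consecutive levels makes flipping digits commute with
  \<open>half\<close>.\<close>

lemma mask_div_2: "mask n a p div 2 = mask n a (p - 1)"
proof (cases "p \<le> n")
  case True
  then have "nat (n - (p - 1)) = Suc (nat (n - p))" by simp
  then show ?thesis using True
    by (simp add: mask_def drop_bit_eq_div div_mult2_eq[symmetric] mult.commute)
next
  case False
  then have "nat (p - n) = Suc (nat (p - 1 - n))" by simp
  moreover have "mask n a (p - 1) = push_bit (nat (p - 1 - n)) a"
    using False by (auto simp: mask_def)
  ultimately show ?thesis using False by (simp add: mask_def push_bit_eq_mult)
qed

lemma xor_div_2: "xor k l div 2 = xor (k div 2) (l div 2)" for k l :: nat
  using drop_bit_xor[of 1 k l] by (simp add: drop_bit_eq_div)

lemma xor_cancel: "xor (xor k l) l = k" for k l :: nat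
  by (simp add: xor.assoc)

lemma half_homogeneous: "\<exists>g. bij g \<and> (\<forall>u. g (half u) = half (g u)) \<and> g z = w"
proof -
  define s where "s = fst w - fst z"
  define M where "M = mask (fst w) (xor (snd z) (snd w))"
  define g where "g u = (fst u + s, xor (snd u) (M (fst u + s)))" for u
  have "bij g"
  proof (rule o_bij)
    let ?h = "\<lambda>u. (fst u - s, xor (snd u) (M (fst u)))"
    show "?h \<circ> g = id" "g \<circ> ?h = id"
      by (simp_all add: g_def fun_eq_iff xor_cancel)
  qed
  moreover have "g (half u) = half (g u)" for u
    by (simp add: g_def half_def xor_div_2 M_def mask_div_2 algebra_simps)
  moreover have "g z = w"
    by (simp add: g_def s_def M_def mask_def xor.assoc[symmetric] prod_eq_iff)
  ultimately show ?thesis by blast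
qed

lemma horo_tree_nat: "horo_tree (\<lambda>v. enc (half (dec v))) (\<lambda>v. fst (dec v))"
proof
  let ?par = "\<lambda>v. enc (half (dec v))"
  have pow: "(?par ^^ n) v = enc ((half ^^ n) (dec v))" for n v
    by (induction n) simp_all
  show "fst (dec (?par v)) = fst (dec v) - 1" for v by (simp add: half_def)
  show "\<exists>m n. (?par ^^ m) u = (?par ^^ n) v" for u v
    unfolding pow using half_common by metis
  show "card {u. ?par u = v} = 2" for v
  proof -
    have eq: "{u. ?par u = v} = enc ` {z. half z = dec v}"
    proof (intro equalityI subsetI)
      fix u assume "u \<in> {u. ?par u = v}"
      then have "half (dec u) = dec v" by auto
      then show "u \<in> enc ` {z. half z = dec v}"
        by (intro image_eqI[of _ _ "dec u"]) simp_all
    qed auto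
    have "inj_on enc A" for A by (metis dec_enc inj_onI)
    then have "card {u. ?par u = v} = card {z. half z = dec v}"
      unfolding eq by (rule card_image)
    then show ?thesis by (simp add: half_children)
  qed
  show "\<exists>g. bij g \<and> (\<forall>z. g (?par z) = ?par (g z)) \<and> g u = v" for u v
  proof -
    obtain g where g: "bij g" "\<And>z. g (half z) = half (g z)" "g (dec u) = dec v"
      using half_homogeneous by blast
    have "bij dec" "bij enc" by (auto intro: o_bij[of enc dec] o_bij[of dec enc] simp: fun_eq_iff)
    then have "bij (\<lambda>v. enc (g (dec v)))" using g(1) bij_comp[of dec g] bij_comp[of "g \<circ> dec" enc]
      by (simp add: comp_def)
    then show ?thesis using g by (intro exI[of _ "\<lambda>v. enc (g (dec v))"]) simp
  qed
qed

theorem mainTheorem6: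
  "\<exists>(V :: nat set) (E :: nat set set) (\<mu> :: nat set set measure).
     transitive_graph V E \<and> \<not> unimodular V E \<and> infinite (ends V E) \<and>
     random_spanning_tree V E \<mu> \<and> Aut_invariant V E \<mu> \<and>
     (AE \<omega> in \<mu>. \<forall>x\<in>V. p_c \<omega> x = 1)"
  using horo_tree.tree_law_properties[OF horo_tree_nat] by blast

end
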